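(* Fix a real number $\alpha > 463/252$. For each prime $p$ let $N=N(p)\ge 2$ and put $u=\frac{\log p}{\log N}$, and suppose that $1\le u=(\log p)^{o(1)}$ as $p\to\infty$. Then, as $p\to\infty$, $$\#\mathcal{Q}_p(N) \ll u\, N\, p^{-(1+o(1))/\lceil \alpha u\rceil},$$ where the implied constant may depend on $\alpha$.
   Context: For a prime $p$ and an integer $u$ with $\gcd(u,p)=1$, the Fermat quotient $q_p(u)$ is the unique integer with $q_p(u)\equiv \frac{u^{p-1}-1}{p} \pmod p$ and $0\le q_p(u)\le p-1$; also $q_p(u)=0$ if $u\equiv 0\pmod p$. For $N\ge 1$, $\mathcal{Q}_p(N)=\{n\le N : n \text{ a positive integer},\ q_p(n)=0\}$. The notation $U\ll V$ means $|U|\le cV$ for some constant $c>0$. *)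

theory Defs
  imports "HOL-Number_Theory.Number_Theory" Complex_Main
begin

text \<open>
  For prime \<open>p\<close> and \<open>coprime u p\<close> the \<open>div\<close> is an exact division, and the definite description
  is well defined: see \<open>fermat_quotient_exact\<close> and \<open>fermat_quotient_unique\<close> below.
\<close>

definition fermat_quotient :: "nat \<Rightarrow> int \<Rightarrow> int" where
  "fermat_quotient p u =
     (if coprime u (int p)
      then THE q. [q = (u ^ (p - 1) - 1) div int p] (mod int p) \<and> 0 \<le> q \<and> q \<le> int p - 1
      else 0)"

text \<open>
  The bound \<open>N\<close> is real, so that \<open>N = p powr (1 / u)\<close> makes sense for every real \<open>u\<close>.
\<close>

definition fermat_zeros :: "nat \<Rightarrow> real \<Rightarrow> nat set" where
  "fermat_zeros p N = {n. 0 < n \<and> real n \<le> N \<and> fermat_quotient p (int n) = 0}"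

definition primes_at_top :: "nat filter" where
  "primes_at_top = inf at_top (principal {p. prime p})"

lemma eventually_primes_at_top:
  "eventually P primes_at_top \<longleftrightarrow> (\<exists>p0. \<forall>p\<ge>p0. prime p \<longrightarrow> P p)"
  by (simp add: primes_at_top_def eventually_inf_principal eventually_at_top_linorder)

lemma fermat_quotient_exact:
  assumes "prime p" "coprime u (int p)"
  shows "int p dvd u ^ (p - 1) - 1"
proof -
  define r where "r = nat (u mod int p)"
  have p: "p > 0" using assms(1) by (simp add: prime_gt_0_nat)
  have r: "int r = u mod int p" using p by (simp add: r_def)
  have "\<not> int p dvd u"
    using assms by (metis coprime_absorb_right not_prime_unit prime_nat_int_transfer)
  then have "\<not> p dvd r"
    using r by (metis dvd_mod_iff dvd_refl int_dvd_int_iff)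
  then have "[r ^ (p - 1) = 1] (mod p)"
    using assms(1) fermat_theorem by blast
  then have "[int r ^ (p - 1) = 1] (mod int p)"
    by (metis cong_int_iff of_nat_1 of_nat_power)
  then have "[u ^ (p - 1) = 1] (mod int p)"
    unfolding r by (simp add: cong_def power_mod)
  then show ?thesis by (simp add: cong_iff_dvd_diff)
qed

lemma fermat_quotient_unique:
  assumes "p > 0"
  shows "\<exists>!q. [q = (u ^ (p - 1) - 1) div int p] (mod int p) \<and> 0 \<le> q \<and> q \<le> int p - 1"
proof (rule ex1I)
  let ?a = "(u ^ (p - 1) - 1) div int p"
  show "[?a mod int p = ?a] (mod int p) \<and> 0 \<le> ?a mod int p \<and> ?a mod int p \<le> int p - 1"
    using assms by (simp add: cong_def)
  show "q = ?a mod int p"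
    if "[q = ?a] (mod int p) \<and> 0 \<le> q \<and> q \<le> int p - 1" for q
    using that by (metis cong_def mod_pos_pos_trivial zle_diff1_eq)
qed

end

theory Submission
  imports
    Defs
    "HOL-Computational_Algebra.Polynomial"
    "HOL-Library.FuncSet"
    "HOL-Analysis.Convex"
    "HOL-Real_Asymp.Real_Asymp"
begin

text \<open>
  If \<open>p\<close> does not divide \<open>n\<close>, then \<open>q_p(n) = 0\<close> means that \<open>n\<close> lies modulo \<open>p^2\<close> in the
  subgroup \<open>\<Gamma>\<close> of \<open>p\<close>-th powers, of order \<open>p - 1\<close>. Products of \<open>k = \<lceil>\<alpha> u\<rceil>\<close> such elements are
  again in \<open>\<Gamma>\<close> and at most \<open>N^k\<close>, which lies between \<open>p^\<alpha>\<close> and \<open>p^(\<alpha> + 1)\<close>; since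
  \<open>u = (log p)^(o(1))\<close>, every integer of this size has only \<open>p^(o(1))\<close> ordered factorizations into
  \<open>k\<close> factors. It remains to see that \<open>\<Gamma>\<close> has \<open>O(M / p)\<close> elements up to \<open>M\<close> if \<open>M \<ge> p^\<alpha>\<close>, and
  for this it suffices that the Heilbronn sum \<open>H = \<Sum>x. exp(2 \<pi> i \<xi> x^p / p^2)\<close> is at most
  \<open>p^(211/252)\<close>.

  Let \<open>E\<close> be the number of solutions in \<open>\<Gamma>\<close> of \<open>a - a' = b - b' = c - c'\<close>. Following Shkredov,
  \<open>H^2\<close> is an eigenvalue of the positive semidefinite matrix with entries \<open>H(\<xi> (x - y))\<close>,
  \<open>x, y \<in> \<Gamma>\<close>; comparing \<open>H^6\<close> with the trace of its cube and applying Cauchy-Schwarz, where both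
  factors turn out to be multiples of \<open>E\<close>, gives \<open>H^6 \<le> p^2 E\<close>. Following Heath-Brown and
  Konyagin, \<open>E\<close> is governed by the number of \<open>x\<close> modulo \<open>p\<close> at which the truncated logarithm takes
  a given value. By Stepanov's method at most \<open>O(p^2 / s^3)\<close> values are taken \<open>s\<close> times or more,
  so \<open>E\<close> is \<open>O(p^3 log p)\<close> and \<open>H\<close> is \<open>O((p^5 log p)^(1/6))\<close>, which suffices because
  \<open>5/6 < 211/252 = 463/252 - 1\<close>.

  As the prime varies, no single type of residues modulo \<open>p\<close> can be fixed; polynomials over the
  prime field are represented by integer polynomials and congruence of their coefficients.
\<close>

section \<open>The Fermat polynomial and congruences modulo a prime\<close>

lemma const_dvd_sub_const:
  fixes g :: "int poly"
  shows "[:-b, 1:] dvd g - [:poly g b:]"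
  by (simp add: poly_eq_0_iff_dvd [symmetric])

text \<open>After the coefficients of \<open>g\<close> are reduced modulo \<open>m\<close>, a
  nonzero remainder \<open>g'\<close> would have a leading coefficient not divisible by
  \<open>m\<close>. As \<open>W\<close> is monic, that coefficient appears in \<open>W * g'\<close>
  in a degree exceeding that of \<open>h\<close>.\<close>

lemma monic_degree_bound_dvd:
  fixes W g h :: "int poly"
  assumes m: "m > 0" and W: "lead_coeff W = 1" and cong: "[:m:] dvd h - W * g"
    and deg: "degree h < degree W"
  shows "[:m:] dvd h"
proof -
  define g' where "g' = map_poly (\<lambda>c. c mod m) g"
  have co: "coeff g' i = coeff g i mod m" for i
    by (simp add: g'_def coeff_map_poly)
  have gg: "[:m:] dvd g - g'"
    by (simp add: const_poly_dvd_iff co)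
  have eq: "h - W * g' = (h - W * g) + W * (g - g')" by (simp add: algebra_simps)
  have c2: "[:m:] dvd h - W * g'"
    unfolding eq by (rule dvd_add[OF cong dvd_mult[OF gg]])
  have "g' = 0"
  proof (rule ccontr)
    assume g0: "g' \<noteq> 0"
    let ?n = "degree W + degree g'"
    have W0: "W \<noteq> 0" using W by auto
    have "coeff (W * g') ?n = lead_coeff g'"
      by (simp add: coeff_mult_degree_sum W)
    moreover have "coeff h ?n = 0" using deg by (intro coeff_eq_0) simp
    moreover have "m dvd coeff (h - W * g') ?n" using c2 const_poly_dvd_iff by blast
    ultimately have "m dvd lead_coeff g'" by simp
    then have "m dvd coeff g (degree g')" by (simp add: co dvd_mod_iff)
    then have "lead_coeff g' = 0" by (simp add: co)
    with g0 show False by simp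
  qed
  then show ?thesis using c2 by simp
qed

section \<open>Polynomial congruences modulo an odd prime and the truncated logarithm\<close>

locale odd_prime =
  fixes p :: nat
  assumes prime: "prime p" and odd: "odd p"
begin

definition pcong :: "int poly \<Rightarrow> int poly \<Rightarrow> bool" where
  "pcong f g \<longleftrightarrow> [:int p:] dvd f - g"

lemma p_gt: "p > 2"
  using prime odd prime_ge_2_nat[OF prime] by (cases "p = 2") auto

lemma prime_int: "prime (int p)"
  using prime by simp

lemma pcong_iff: "pcong f g \<longleftrightarrow> (\<forall>i. int p dvd coeff f i - coeff g i)"
  by (simp add: pcong_def const_poly_dvd_iff)

lemma pcong_refl [simp]: "pcong f f"
  by (simp add: pcong_def)

lemma pcong_trans [trans]: "pcong f g \<Longrightarrow> pcong g h \<Longrightarrow> pcong f h"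
  using dvd_add[of "[:int p:]" "f - g" "g - h"] unfolding pcong_def by simp

lemma pcong_add: "pcong f g \<Longrightarrow> pcong f' g' \<Longrightarrow> pcong (f + f') (g + g')"
  using dvd_add[of "[:int p:]" "f - g" "f' - g'"] unfolding pcong_def by (simp add: algebra_simps)

lemma pcong_mult: "pcong f g \<Longrightarrow> pcong f' g' \<Longrightarrow> pcong (f * f') (g * g')"
proof -
  assume a: "pcong f g" "pcong f' g'"
  have "f * f' - g * g' = (f - g) * f' + g * (f' - g')" by (simp add: algebra_simps)
  then show ?thesis using a unfolding pcong_def by (simp only: dvd_add dvd_mult dvd_mult2)
qed

lemma pcong_sum: "(\<And>i. i \<in> S \<Longrightarrow> pcong (f i) (g i)) \<Longrightarrow> pcong (sum f S) (sum g S)"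
  by (induction S rule: infinite_finite_induct) (auto intro!: pcong_add)

lemma pcong_pderiv: "pcong f g \<Longrightarrow> pcong (pderiv f) (pderiv g)"
  by (auto simp: pcong_iff coeff_pderiv right_diff_distrib [symmetric] intro: dvd_mult)

lemma pcong_poly: "pcong f g \<Longrightarrow> [poly f a = poly g a] (mod int p)"
proof -
  assume "pcong f g"
  then obtain k where "f - g = [:int p:] * k" unfolding pcong_def by (elim dvdE)
  from arg_cong[OF this, of "\<lambda>h. poly h a"] have "poly f a - poly g a = int p * poly k a"
    by simp
  then show ?thesis by (simp add: cong_iff_dvd_diff)
qed

lemma dvd_prime_cancel: "\<not> int p dvd a \<Longrightarrow> int p dvd a * b \<Longrightarrow> int p dvd b"
  using prime_int by (simp add: prime_dvd_mult_iff)

lemma nondvd_of_bounds: "0 < \<bar>a\<bar> \<Longrightarrow> \<bar>a\<bar> < int p \<Longrightarrow> \<not> int p dvd a"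
  by (metis abs_of_nat dvd_imp_le_int linorder_not_less zero_less_abs_iff)

text \<open>The integral model of the truncated logarithm: modulo \<open>p\<close> it is
  \<open>x + x^2/2 + \<dots> + x^(p-1)/(p-1)\<close>.\<close>
definition F :: "int poly" where
  "F = (1 + [:-1, 1:] ^ p - [:0, 1:] ^ p) div [:int p:]"

text \<open>The inner binomial coefficients are divisible by \<open>p\<close>; the two end terms
  cancel against \<open>1\<close> and \<open>[:0, 1:] ^ p\<close>, the constant one because
  \<open>p\<close> is odd.\<close>

lemma fermat_poly_dvd: "[:int p:] dvd 1 + [:-1, 1:] ^ p - [:0, 1:] ^ p"
proof -
  have e: "[:-1, 1:] = [:0, 1:] + ([:-1:] :: int poly)" by simp
  have expand: "of_nat (p choose k) * [:0, 1:] ^ k * [:-1:] ^ (p - k)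
      = ([:int (p choose k) * (-1) ^ (p - k):] * [:0, 1:] ^ k :: int poly)" for k
    by (simp add: of_nat_poly poly_const_pow mult.commute mult.left_commute)
  have mid: "[:int p:] dvd of_nat (p choose k) * [:0, 1:] ^ k * [:-1:] ^ (p - k)"
    if "k \<in> {1..<p}" for k
  proof -
    have "p dvd (p choose k)" using that prime by (intro dvd_choose_prime) auto
    then have "int p dvd int (p choose k) * (-1) ^ (p - k)" by simp
    then show ?thesis unfolding expand
      by (intro dvd_mult2) (simp add: const_poly_dvd_iff coeff_pCons split: nat.splits)
  qed
  have "[:-1, 1:] ^ p = (\<Sum>k\<le>p. of_nat (p choose k) * [:0, 1:] ^ k * ([:-1:] :: int poly) ^ (p - k))"
    unfolding e by (rule binomial_ring)
  also have "{..p} = insert 0 (insert p {1..<p})" using p_gt by auto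
  also have "(\<Sum>k\<in>\<dots>. of_nat (p choose k) * [:0, 1:] ^ k * ([:-1:] :: int poly) ^ (p - k)) =
     [:-1:] ^ p + ([:0,1:] ^ p + (\<Sum>k\<in>{1..<p}. of_nat (p choose k) * [:0, 1:] ^ k * [:-1:] ^ (p - k)))"
    using p_gt by (subst sum.insert, simp, simp, subst sum.insert, simp, simp, simp)
  finally have "1 + [:-1, 1:] ^ p - [:0, 1:] ^ p =
      (\<Sum>k\<in>{1..<p}. of_nat (p choose k) * [:0, 1:] ^ k * ([:-1:] :: int poly) ^ (p - k))"
    using odd by (simp add: poly_const_pow one_pCons)
  then show ?thesis by (simp only: dvd_sum mid)
qed

lemma F_eq: "[:int p:] * F = 1 + [:-1, 1:] ^ p - [:0, 1:] ^ p"
  unfolding F_def using fermat_poly_dvd by (rule dvd_mult_div_cancel)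

lemma poly_F: "int p * poly F a = 1 + (a - 1) ^ p - a ^ p"
  using arg_cong[OF F_eq, of "\<lambda>h. poly h a"] by simp

lemma degree_F: "degree F \<le> p"
proof -
  have "degree F = degree ([:int p:] * F)" using p_gt by simp
  also have "\<dots> \<le> p" unfolding F_eq
    by (intro degree_diff_le degree_add_le)
       (auto simp: degree_linear_power intro!: order_trans[OF degree_power_le])
  finally show ?thesis .
qed

lemma coeff_F_0: "coeff F 0 = 0"
proof -
  have "int p * poly F 0 = 0" using odd p_gt by (subst poly_F) simp
  then show ?thesis using p_gt by (simp add: poly_0_coeff_0)
qed

lemma pderiv_F: "pderiv F = [:-1, 1:] ^ (p - 1) - [:0, 1:] ^ (p - 1)"
proof -
  have "[:int p:] * pderiv F = pderiv ([:int p:] * F)"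
    by (simp add: pderiv_smult)
  also have "\<dots> = [:int p:] * ([:-1, 1:] ^ (p - 1) - [:0, 1:] ^ (p - 1))"
    unfolding F_eq by (simp add: pderiv_add pderiv_diff pderiv_power pderiv_pCons smult_diff_right)
  finally show ?thesis using p_gt by (subst (asm) mult_left_cancel) auto
qed

text \<open>The truncated form of the differential equation (1 - x) f' = 1 of -log (1 - x). It
  follows from \<open>pderiv_F\<close> because (x - 1)^p = x^p - 1 modulo \<open>p\<close>.\<close>

lemma one_minus_X_pderiv_F: "pcong ([:1, -1:] * pderiv F) (1 - [:0, 1:] ^ (p - 1))"
proof -
  have p: "p = Suc (p - 1)" using p_gt by simp
  have "[:1, -1:] * pderiv F = - ([:-1, 1:] ^ p) + [:0, 1:] ^ p - [:0, 1:] ^ (p - 1)"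
  proof -
    have a: "[:1, -1:] = - [:-1, 1:]" "[:1, -1:] = 1 - ([:0, 1:] :: int poly)" by (simp_all add: one_pCons)
    have "[:1, -1:] * pderiv F = [:1, -1:] * [:-1, 1:] ^ (p - 1) - [:1, -1:] * [:0, 1:] ^ (p - 1)"
      by (simp only: pderiv_F right_diff_distrib)
    also have "[:1, -1:] * [:-1, 1:] ^ (p - 1) = - ([:-1, 1:] ^ p :: int poly)"
      by (subst (2) p, subst power_Suc, subst a(1)) (rule mult_minus_left)
    also have "[:1, -1:] * [:0, 1:] ^ (p - 1) = [:0, 1:] ^ (p - 1) - ([:0, 1:] ^ p :: int poly)"
      by (subst (3) p, subst power_Suc, subst a(2)) (simp only: left_diff_distrib mult_1_left)
    finally show ?thesis by simp
  qed
  moreover have "pcong (- ([:-1, 1:] ^ p) + [:0, 1:] ^ p - [:0, 1:] ^ (p - 1)) (1 - [:0, 1:] ^ (p - 1))"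
  proof -
    have "[:int p:] dvd - (1 + [:-1, 1:] ^ p - [:0, 1:] ^ p)"
      using fermat_poly_dvd by (simp only: dvd_minus_iff)
    then show ?thesis unfolding pcong_def by (simp add: algebra_simps)
  qed
  ultimately show ?thesis by simp
qed

text \<open>The factor \<open>x (1 - x)\<close> clears the denominators of the derivatives of \<open>F\<close>
  modulo \<open>p\<close>.\<close>
definition \<theta> :: "int poly \<Rightarrow> int poly" where
  "\<theta> h = [:0, 1, -1:] * pderiv h"

lemma \<theta>_add: "\<theta> (f + g) = \<theta> f + \<theta> g"
  by (simp only: \<theta>_def pderiv_add distrib_left)

lemma \<theta>_diff: "\<theta> (f - g) = \<theta> f - \<theta> g"
  by (simp only: \<theta>_def pderiv_diff right_diff_distrib)

lemma \<theta>_mult: "\<theta> (f * g) = \<theta> f * g + f * \<theta> g"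
  unfolding \<theta>_def pderiv_mult by (simp only: algebra_simps)

lemma \<theta>_pcong: "pcong f g \<Longrightarrow> pcong (\<theta> f) (\<theta> g)"
  unfolding \<theta>_def by (intro pcong_mult pcong_pderiv pcong_refl)

lemma \<theta>_iter_pcong: "pcong f g \<Longrightarrow> pcong ((\<theta> ^^ n) f) ((\<theta> ^^ n) g)"
  by (induction n) (auto intro: \<theta>_pcong)

lemma \<theta>_iter_diff: "(\<theta> ^^ n) (f - g) = (\<theta> ^^ n) f - (\<theta> ^^ n) g"
  by (induction n) (auto simp: \<theta>_diff)

lemma degree_\<theta>: "degree (\<theta> f) \<le> Suc (degree f)"
proof (cases "degree f = 0")
  case True
  then have "pderiv f = 0" by (simp add: pderiv_eq_0_iff)
  then show ?thesis by (simp add: \<theta>_def)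
next
  case False
  have "degree (\<theta> f) \<le> degree [:0, 1, -1 :: int:] + degree (pderiv f)"
    unfolding \<theta>_def by (rule degree_mult_le)
  also have "\<dots> \<le> Suc (degree f)" using False by (simp add: degree_pderiv)
  finally show ?thesis .
qed

lemma \<theta>_power: "\<theta> (f ^ n) = of_nat n * f ^ (n - 1) * \<theta> f"
  by (simp add: \<theta>_def pderiv_power of_nat_poly mult.left_commute)

text \<open>Consequently \<open>\<theta>\<close> preserves, modulo \<open>p\<close>, the ring
  generated by x, \<open>F\<close> and x^p.\<close>

lemma \<theta>_F: "pcong (\<theta> F) ([:0, 1:] - [:0, 1:] ^ p)"
proof -
  have a: "\<theta> F = [:0, 1:] * ([:1, -1:] * pderiv F)" by (simp add: \<theta>_def)
  have "[:0, 1:] * (1 - [:0, 1:] ^ (p - 1)) = [:0, 1:] - ([:0, 1:] ^ p :: int poly)"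
    using p_gt by (simp only: right_diff_distrib mult_1_right power_Suc [symmetric]) simp
  then show ?thesis unfolding a
    using pcong_mult[OF pcong_refl one_minus_X_pderiv_F, of "[:0, 1:]"] by simp
qed

lemma \<theta>_X_power_p: "pcong (\<theta> ([:0, 1:] ^ (p * c))) 0"
proof -
  have "[:int p:] dvd of_nat (p * c)"
    by (auto simp: of_nat_poly const_poly_dvd_iff coeff_pCons split: nat.splits)
  then show ?thesis unfolding pcong_def \<theta>_power by (simp only: diff_zero dvd_mult2)
qed

text \<open>\<open>rep k h\<close>: modulo \<open>p\<close>, \<open>h\<close> is a combination of products \<open>Q F^b x^(p c)\<close> with
  \<open>degree Q + c \<le> k\<close>. At a point of \<open>\<int>/p\<close> with \<open>F = t\<close> such a combination
  collapses to a polynomial of degree at most \<open>k\<close>.\<close>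
inductive rep :: "nat \<Rightarrow> int poly \<Rightarrow> bool" where
  rep_term: "degree Q + c \<le> k \<Longrightarrow> rep k (Q * F ^ b * [:0, 1:] ^ (p * c))"
| rep_add: "rep k g \<Longrightarrow> rep k h \<Longrightarrow> rep k (g + h)"
| rep_pcong: "rep k g \<Longrightarrow> pcong h g \<Longrightarrow> rep k h"

lemma rep_0: "rep k 0"
  using rep_term[of 0 0 k 0] by simp

lemma rep_sum: "(\<And>i. i \<in> S \<Longrightarrow> rep k (f i)) \<Longrightarrow> rep k (sum f S)"
  by (induction S rule: infinite_finite_induct) (auto intro: rep_0 rep_add)

text \<open>By the product rule, \<open>\<theta>\<close> either raises the degree of
  \<open>Q\<close> by at most one, or replaces a factor \<open>F\<close> by x - x^p, which costs one
  degree of \<open>Q\<close> or one factor x^p. The powers of x^p behave as constants.\<close>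

lemma rep_\<theta>: "rep k h \<Longrightarrow> rep (Suc k) (\<theta> h)"
proof (induction rule: rep.induct)
  case (rep_term Q c k b)
  let ?X = "[:0, 1:] :: int poly"
  have "\<theta> (Q * F ^ b * ?X ^ (p * c)) =
     \<theta> Q * F ^ b * ?X ^ (p * c) + Q * (of_nat b * F ^ (b - 1)) * \<theta> F * ?X ^ (p * c)
      + Q * F ^ b * \<theta> (?X ^ (p * c))"
    unfolding \<theta>_mult \<theta>_power[of F b] by (simp only: algebra_simps)
  also have "pcong \<dots> (\<theta> Q * F ^ b * ?X ^ (p * c)
      + Q * (of_nat b * F ^ (b - 1)) * (?X - ?X ^ p) * ?X ^ (p * c) + Q * F ^ b * 0)"
    by (intro pcong_add pcong_mult pcong_refl \<theta>_F \<theta>_X_power_p)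
  also have "\<theta> Q * F ^ b * ?X ^ (p * c)
      + Q * (of_nat b * F ^ (b - 1)) * (?X - ?X ^ p) * ?X ^ (p * c) + Q * F ^ b * 0 =
      \<theta> Q * F ^ b * ?X ^ (p * c) + ((of_nat b * ?X * Q) * F ^ (b - 1) * ?X ^ (p * c)
      + (- (of_nat b * Q)) * F ^ (b - 1) * ?X ^ (p * Suc c))"
    unfolding mult_Suc_right power_add by (simp add: algebra_simps del: mult_pCons_left mult_pCons_right)
  finally have c: "pcong (\<theta> (Q * F ^ b * ?X ^ (p * c))) \<dots>" .
  have d1: "degree (of_nat b * Q) \<le> degree Q"
    by (rule order_trans[OF degree_mult_le]) simp
  have d2: "degree (of_nat b * ?X * Q) \<le> Suc (degree Q)"
  proof -
    have "degree (of_nat b * ?X * Q) \<le> degree ?X + degree (of_nat b * Q)"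
      using degree_mult_le[of ?X "of_nat b * Q"]
      by (simp only: mult.assoc mult.left_commute[of "of_nat b" ?X])
    then show ?thesis using d1 by simp
  qed
  show ?case
  proof (rule rep_pcong[OF _ c], intro rep_add)
    show "rep (Suc k) (\<theta> Q * F ^ b * ?X ^ (p * c))"
      using rep_term degree_\<theta>[of Q] by (intro rep.rep_term) simp
    show "rep (Suc k) (of_nat b * ?X * Q * F ^ (b - 1) * ?X ^ (p * c))"
      using rep_term d2 by (intro rep.rep_term) simp
    show "rep (Suc k) (- (of_nat b * Q) * F ^ (b - 1) * ?X ^ (p * Suc c))"
      using rep_term d1 by (intro rep.rep_term) simp
  qed
next
  case (rep_add k g h)
  then show ?case by (simp add: \<theta>_add rep.rep_add)
next
  case (rep_pcong k g h)
  then show ?case by (metis \<theta>_pcong rep.rep_pcong)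
qed

lemma rep_\<theta>_iter: "rep k h \<Longrightarrow> rep (k + n) ((\<theta> ^^ n) h)"
  by (induction n) (auto intro: rep_\<theta>)

lemma fermat_int: "[a ^ p = a] (mod int p)"
proof (cases "int p dvd a")
  case True
  moreover have "int p dvd a ^ p" using dvd_trans[OF True dvd_power[of p a]] p_gt by simp
  ultimately show ?thesis by (simp add: cong_iff_dvd_diff)
next
  case False
  then have "coprime a (int p)"
    by (metis coprime_commute prime_imp_coprime prime_int)
  then have "int p dvd a ^ (p - 1) - 1" using fermat_quotient_exact prime by blast
  then have "[a ^ (p - 1) * a = 1 * a] (mod int p)"
    by (intro cong_mult cong_refl) (simp add: cong_iff_dvd_diff)
  then show ?thesis using p_gt by (simp add: power_Suc2[symmetric] del: power_Suc2)
qed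

text \<open>On the fibre of \<open>t\<close>, Fermat turns x^p into x, and powers of
  \<open>F\<close> become constants, so \<open>b\<close> does not enter the degree. One
  \<open>Q\<close> serves the whole fibre; hence Stepanov's conditions are counted per value and not
  per point.\<close>

lemma rep_eval: "rep k h \<Longrightarrow> \<exists>Q. degree Q \<le> k \<and>
    (\<forall>a. [poly F a = t] (mod int p) \<longrightarrow> [poly h a = poly Q a] (mod int p))"
proof (induction rule: rep.induct)
  case (rep_term Q c k b)
  let ?Q = "Q * ([:t:] ^ b) * [:0, 1:] ^ c"
  have "degree ?Q \<le> degree (Q * [:t:] ^ b) + degree ([:0, 1 :: int:] ^ c)" by (rule degree_mult_le)
  also have "degree (Q * [:t:] ^ b) \<le> degree Q + degree ([:t:] ^ b)" by (rule degree_mult_le)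
  also have "degree ([:t:] ^ b) = 0" by (simp add: poly_const_pow)
  also have "degree ([:0, 1 :: int:] ^ c) = c" by (rule degree_linear_power)
  finally have "degree ?Q \<le> k" using rep_term by simp
  moreover have "[poly (Q * F ^ b * [:0, 1:] ^ (p * c)) a = poly ?Q a] (mod int p)"
    if "[poly F a = t] (mod int p)" for a
    unfolding poly_mult poly_power power_mult using that
    by (intro cong_mult cong_refl cong_pow) (auto simp: fermat_int)
  ultimately show ?case by blast
next
  case (rep_add k g h)
  then obtain Q Q' where "degree Q \<le> k" "degree Q' \<le> k"
    "\<forall>a. [poly F a = t] (mod int p) \<longrightarrow> [poly g a = poly Q a] (mod int p)"
    "\<forall>a. [poly F a = t] (mod int p) \<longrightarrow> [poly h a = poly Q' a] (mod int p)" by blast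
  then show ?case by (intro exI[of _ "Q + Q'"]) (auto intro: degree_add_le cong_add)
next
  case (rep_pcong k g h)
  then show ?case by (meson cong_trans pcong_poly)
qed

text \<open>Each \<open>\<theta>\<close> lowers the order of the zero at \<open>a\<close> by one and
  contributes the current exponent times the value a (1 - a) of \<open>\<theta> [:-a, 1:]\<close> at
  \<open>a\<close>.\<close>

lemma \<theta>_iter_root_power:
  "poly ((\<theta> ^^ m) ([:-a, 1:] ^ m * G)) a = fact m * (a * (1 - a)) ^ m * poly G a"
proof (induction m arbitrary: G)
  case (Suc m)
  let ?L = "[:-a, 1:]"
  have "\<theta> (?L ^ Suc m * G) = ?L ^ m * (of_nat (Suc m) * \<theta> ?L * G + ?L * \<theta> G)"
    unfolding \<theta>_mult \<theta>_power[of ?L "Suc m"] by (simp add: algebra_simps)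
  then have "(\<theta> ^^ Suc m) (?L ^ Suc m * G) = (\<theta> ^^ m) (?L ^ m * (of_nat (Suc m) * \<theta> ?L * G + ?L * \<theta> G))"
    by (simp add: funpow_swap1)
  then have "poly ((\<theta> ^^ Suc m) (?L ^ Suc m * G)) a =
      fact m * (a * (1 - a)) ^ m * poly (of_nat (Suc m) * \<theta> ?L * G + ?L * \<theta> G) a"
    using Suc by simp
  also have "poly (of_nat (Suc m) * \<theta> ?L * G + ?L * \<theta> G) a = of_nat (Suc m) * (a * (1 - a)) * poly G a"
    by (simp add: \<theta>_def pderiv_pCons of_nat_poly algebra_simps)
  finally show ?case by (simp add: algebra_simps)
qed simp

lemma not_dvd_fact: "m < p \<Longrightarrow> \<not> int p dvd fact m"
  using prime_dvd_fact_iff[OF prime] by (metis int_dvd_int_iff linorder_not_le of_nat_fact)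

text \<open>A polynomial whose first \<open>D\<close> derivatives vanish modulo \<open>p\<close> at all points of \<open>S\<close> is
  divisible modulo \<open>p\<close> by the product of the \<open>(x - a)^D\<close>.\<close>
lemma vanish_factor:
  assumes "finite S" and "D \<le> p"
    and "\<And>a. a \<in> S \<Longrightarrow> 1 < a \<and> a < int p"
    and "\<And>a n. a \<in> S \<Longrightarrow> n < D \<Longrightarrow> int p dvd poly ((\<theta> ^^ n) h) a"
  shows "\<exists>g. pcong h ((\<Prod>a\<in>S. [:-a, 1:] ^ D) * g)"
  using assms(1,3,4)
proof (induction S rule: finite_induct)
  case empty
  show ?case by (intro exI[of _ h]) simp
next
  case (insert b S)
  let ?W = "\<Prod>a\<in>S. [:-a, 1:] ^ D"
  have b: "1 < b" "b < int p" using insert.prems by auto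
  obtain g where g: "pcong h (?W * g)" using insert by auto
  \<comment> \<open>The points of the range are pairwise incongruent modulo \<open>p\<close>, so the
    factors already split off are units at \<open>b\<close>.\<close>
  have Wb: "\<not> int p dvd poly ?W b"
  proof -
    have "\<not> int p dvd b - a" if "a \<in> S" for a
      using that insert(2) insert.prems(1)[of a] b by (intro nondvd_of_bounds) auto
    then show ?thesis using insert(1) prime_int prime_dvd_power[OF prime_int]
      by (auto simp: poly_prod prime_dvd_prod_iff)
  qed
  \<comment> \<open>The factors x - b are split off one at a time: the \<open>m\<close>-th condition
    says that a unit times \<open>poly g b\<close> vanishes modulo \<open>p\<close>. The unit
    requires \<open>m < p\<close> and \<open>b\<close> different from 0 and 1 modulo
    \<open>p\<close>.\<close>
  have "\<exists>g. pcong h (?W * ([:-b, 1:] ^ m * g))" if "m \<le> D" for m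
    using that
  proof (induction m)
    case 0
    then show ?case using g by (intro exI[of _ g]) simp
  next
    case (Suc m)
    then obtain g where g: "pcong h (?W * ([:-b, 1:] ^ m * g))" by auto
    let ?v = "fact m * (b * (1 - b)) ^ m * poly ?W b"
    have "[poly ((\<theta> ^^ m) h) b = poly ((\<theta> ^^ m) ([:-b, 1:] ^ m * (?W * g))) b] (mod int p)"
      using pcong_poly[OF \<theta>_iter_pcong[OF g]] by (simp only: mult.left_commute)
    moreover have "int p dvd poly ((\<theta> ^^ m) h) b" using insert.prems(2) Suc by auto
    ultimately have "int p dvd ?v * poly g b"
      unfolding \<theta>_iter_root_power by (simp add: cong_dvd_iff mult.assoc)
    moreover have "\<not> int p dvd ?v"
    proof -
      have "\<not> int p dvd b" "\<not> int p dvd 1 - b" 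
        using b nondvd_of_bounds[of b] nondvd_of_bounds[of "1 - b"] by auto
      then have "\<not> int p dvd (b * (1 - b)) ^ m"
        using prime_dvd_power[OF prime_int] prime_dvd_multD[OF prime_int, of b "1 - b"] by blast
      moreover have "\<not> int p dvd fact m" using Suc assms(2) by (intro not_dvd_fact) simp
      ultimately show ?thesis using Wb prime_int by (simp add: prime_dvd_mult_iff)
    qed
    ultimately have gb: "int p dvd poly g b" by (rule dvd_prime_cancel[rotated])
    obtain g' where g': "g - [:poly g b:] = [:-b, 1:] * g'" using const_dvd_sub_const by (metis dvdE)
    have "pcong g ([:-b, 1:] * g')"
      unfolding pcong_def g'[symmetric] using gb
      by (auto simp: const_poly_dvd_iff coeff_pCons split: nat.splits)
    then have "pcong (?W * ([:-b, 1:] ^ m * g)) (?W * ([:-b, 1:] ^ m * ([:-b, 1:] * g')))"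
      by (intro pcong_mult pcong_refl)
    with g have "pcong h (?W * ([:-b, 1:] ^ m * ([:-b, 1:] * g')))" by (rule pcong_trans)
    then show ?case by (intro exI[of _ g']) (simp only: power_Suc2 mult.assoc)
  qed
  from this[of D] show ?case using insert by (simp add: mult.assoc mult.left_commute)
qed

text \<open>The monic product in \<open>vanish_factor\<close> has degree \<open>D * card S\<close>,
  too large for \<open>h\<close>.\<close>

lemma vanish_imp_pcong_0:
  assumes "finite S" and "D \<le> p"
    and "\<And>a. a \<in> S \<Longrightarrow> 1 < a \<and> a < int p"
    and "\<And>a n. a \<in> S \<Longrightarrow> n < D \<Longrightarrow> int p dvd poly ((\<theta> ^^ n) h) a"
    and "degree h < D * card S"
  shows "pcong h 0"
proof -
  let ?W = "\<Prod>a\<in>S. [:-a, 1:] ^ D"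
  obtain g where g: "pcong h (?W * g)" using vanish_factor[OF assms(1-4)] by blast
  have "degree ?W = (\<Sum>a\<in>S. degree ([:-a, 1:] ^ D))"
    by (rule degree_prod_eq_sum_degree) simp
  also have "\<dots> = D * card S" by (simp add: degree_linear_power)
  finally have dW: "degree ?W = D * card S" .
  have "lead_coeff ?W = 1" by (simp add: lead_coeff_prod lead_coeff_power)
  then have "[:int p:] dvd h"
    using monic_degree_bound_dvd[of "int p" ?W h g] g assms(5) dW p_gt unfolding pcong_def by simp
  then show ?thesis by (simp add: pcong_def)
qed

end

section \<open>The auxiliary polynomial\<close>

context odd_prime
begin

text \<open>Truncated logarithm analogue of the linear independence of \<open>x\<close> and \<open>log (1 - x)\<close>:
  the operator \<open>(1 - x) d/dx + c\<close> lowers one of the degree bounds \<open>w\<close> and costs one order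
  of vanishing at \<open>0\<close>.\<close>
lemma log_independence:
  assumes "A \<le> p" and "(\<Sum>a<A. w a) \<le> n" and "n \<le> p"
    and "\<And>a i. a < A \<Longrightarrow> w a \<le> i \<Longrightarrow> int p dvd coeff (g a) i"
    and "\<And>i. i < n \<Longrightarrow> int p dvd coeff (\<Sum>a<A. [:1, -1:] ^ a * pcompose (g a) F) i"
    and "a < A"
  shows "int p dvd coeff (g a) i"
  using assms(2-)
proof (induction "\<Sum>a<A. w a" arbitrary: w n g a i)
  case 0
  then have "w a = 0" by simp
  then show ?case using 0 by auto
next
  case (Suc s)
  define H where "H = (\<Sum>a<A. [:1, -1:] ^ a * pcompose (g a) F)"
  have "\<exists>a0<A. w a0 \<noteq> 0"
    using Suc.hyps(2) by (metis lessThan_iff nat.distinct(1) sum.neutral)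
  then obtain a0 where a0: "a0 < A" "w a0 \<noteq> 0" by blast
  define w' where "w' = w(a0 := w a0 - 1)"
  \<comment> \<open>Applied to (1 - x)^a g_a(F), the operator (1 - x) d/dx + a0 gives (1 - x)^a
    g'_a(F), modulo \<open>p\<close> and up to a multiple of x^(p-1). For \<open>a = a0\<close> only
    the derivative of \<open>g a0\<close> remains, so that degree bound drops by one.\<close>
  define g' where "g' a = pderiv (g a) + smult (int a0 - int a) (g a)" for a
  have sum_w: "(\<Sum>a<A. w a) = Suc (\<Sum>a<A. w' a)"
  proof -
    have "(\<Sum>a<A. w a) = w a0 + (\<Sum>a\<in>{..<A} - {a0}. w a)"
      using a0 by (intro sum.remove) auto
    moreover have "(\<Sum>a<A. w' a) = w' a0 + (\<Sum>a\<in>{..<A} - {a0}. w' a)"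
      using a0 by (intro sum.remove) auto
    moreover have "(\<Sum>a\<in>{..<A} - {a0}. w' a) = (\<Sum>a\<in>{..<A} - {a0}. w a)"
      by (intro sum.cong) (auto simp: w'_def)
    ultimately show ?thesis using a0 by (simp add: w'_def)
  qed
  have n: "n \<noteq> 0" using Suc.hyps(2) Suc.prems(1) by auto
  have coeff_g': "coeff (g' b) i = int (Suc i) * coeff (g b) (Suc i) + (int a0 - int b) * coeff (g b) i" for b i
    by (simp add: g'_def coeff_pderiv)
  have bound': "int p dvd coeff (g' b) i" if "b < A" "w' b \<le> i" for b i
  proof -
    have 1: "int p dvd coeff (g b) (Suc i)"
      using that Suc.prems(3) by (intro Suc.prems(3)) (auto simp: w'_def split: if_splits)
    have 2: "int p dvd (int a0 - int b) * coeff (g b) i"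
      using that Suc.prems(3) by (cases "b = a0") (auto simp: w'_def)
    show ?thesis using 1 2 unfolding coeff_g' by auto
  qed
  have pd: "pcong ([:1, -1:] * pderiv ([:1, -1:] ^ b * pcompose (g b) F) +
      smult (int a0) ([:1, -1:] ^ b * pcompose (g b) F))
      ([:1, -1:] ^ b * pcompose (g' b) F -
       [:0, 1:] ^ (p - 1) * ([:1, -1:] ^ b * pcompose (pderiv (g b)) F))" for b
  proof -
    let ?L = "[:1, -1 :: int:]" and ?G = "pcompose (g b) F" and ?G' = "pcompose (pderiv (g b)) F"
    have smult_conv: "smult k f = [:k:] * f" for k :: int and f by simp
    have L: "?L * pderiv (?L ^ b) = - of_nat b * ?L ^ b"
      by (cases b) (simp_all add: pderiv_power pderiv_pCons of_nat_poly del: mult_pCons_left power_Suc,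
        simp add: smult_add_left smult_diff_left)
    have "?L * pderiv (?L ^ b * ?G) + smult (int a0) (?L ^ b * ?G) =
       ?L * pderiv (?L ^ b) * ?G + ?L ^ b * (?G' * (?L * pderiv F)) + [:int a0:] * (?L ^ b * ?G)"
      unfolding smult_conv
      by (simp add: pderiv_mult pderiv_pcompose algebra_simps del: mult_pCons_left mult_pCons_right)
    also have "\<dots> = ?L ^ b * (?G' * (?L * pderiv F)) + (of_int (int a0 - int b)) * (?L ^ b * ?G)"
      unfolding L by (simp add: algebra_simps of_nat_poly smult_diff_left)
    also have "pcong \<dots> (?L ^ b * (?G' * (1 - [:0, 1:] ^ (p - 1))) + (of_int (int a0 - int b)) * (?L ^ b * ?G))"
      by (intro pcong_add pcong_mult pcong_refl one_minus_X_pderiv_F)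
    also have "?L ^ b * (?G' * (1 - [:0, 1:] ^ (p - 1))) + (of_int (int a0 - int b)) * (?L ^ b * ?G) =
      ?L ^ b * pcompose (g' b) F - [:0, 1:] ^ (p - 1) * (?L ^ b * ?G')"
    proof -
      have "pcompose (g' b) F = ?G' + of_int (int a0 - int b) * ?G"
        unfolding g'_def by (simp add: pcompose_add pcompose_smult of_int_poly)
      then show ?thesis by (simp only: algebra_simps)
    qed
    finally show ?thesis .
  qed
  define E where "E = (\<Sum>b<A. [:1, -1:] ^ b * pcompose (pderiv (g b)) F)"
  define H' where "H' = (\<Sum>b<A. [:1, -1:] ^ b * pcompose (g' b) F)"
  have "pcong (\<Sum>b<A. [:1, -1:] * pderiv ([:1, -1:] ^ b * pcompose (g b) F) +
      smult (int a0) ([:1, -1:] ^ b * pcompose (g b) F))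
      (\<Sum>b<A. [:1, -1:] ^ b * pcompose (g' b) F -
       [:0, 1:] ^ (p - 1) * ([:1, -1:] ^ b * pcompose (pderiv (g b)) F))"
    by (intro pcong_sum pd)
  moreover have "(\<Sum>b<A. [:1, -1:] * pderiv ([:1, -1:] ^ b * pcompose (g b) F) +
      smult (int a0) ([:1, -1:] ^ b * pcompose (g b) F)) = [:1, -1:] * pderiv H + smult (int a0) H"
  proof -
    have s: "smult k (sum f I) = (\<Sum>i\<in>I. smult k (f i))" for k :: int and f and I :: "nat set"
      using sum_distrib_left[of "[:k:]" f I] by simp
    show ?thesis unfolding H_def sum.distrib s higher_pderiv_sum[of 1, simplified]
      by (simp only: sum_distrib_left)
  qed
  moreover have "(\<Sum>b<A. [:1, -1:] ^ b * pcompose (g' b) F -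
       [:0, 1:] ^ (p - 1) * ([:1, -1:] ^ b * pcompose (pderiv (g b)) F)) = H' - [:0, 1:] ^ (p - 1) * E"
    unfolding H'_def E_def sum_subtractf by (simp only: sum_distrib_left)
  ultimately have HH: "pcong ([:1, -1:] * pderiv H + smult (int a0) H) (H' - [:0, 1:] ^ (p - 1) * E)"
    by simp
  have van': "int p dvd coeff H' i" if "i < n - 1" for i
  proof -
    have "int p dvd coeff H j" if "j \<le> Suc i" for j
      using Suc.prems(4) that \<open>i < n - 1\<close> unfolding H_def by auto
    then have "int p dvd coeff ([:1, -1:] * pderiv H + smult (int a0) H) i"
      by (cases i) (auto simp: coeff_pderiv coeff_pCons)
    \<comment> \<open>The truncation error starts in degree \<open>p - 1\<close>, beyond the
      coefficients considered here.\<close>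
    moreover have "coeff ([:0, 1:] ^ (p - 1) * E) i = 0"
      using that Suc.prems(2) by (simp add: monom_altdef[symmetric, of 1, simplified] coeff_monom_mult)
    moreover have "int p dvd coeff ([:1, -1:] * pderiv H + smult (int a0) H) i -
        coeff (H' - [:0, 1:] ^ (p - 1) * E) i"
      using HH unfolding pcong_iff by blast
    ultimately show ?thesis by (simp add: dvd_diff_right_iff)
  qed
  have g'0: "int p dvd coeff (g' b) i" if "b < A" for b i
  proof (rule Suc.hyps(1)[of w' "n - 1" g' b])
    show "s = (\<Sum>a<A. w' a)" using sum_w Suc.hyps(2) by simp
    show "(\<Sum>a<A. w' a) \<le> n - 1" using sum_w Suc.prems(1) by simp
    show "n - 1 \<le> p" using Suc.prems(2) by simp
  qed (use bound' van' that in \<open>auto simp: H'_def\<close>)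
  \<comment> \<open>Descending induction on the index: once the next coefficient vanishes modulo
    \<open>p\<close>, the one of \<open>g'\<close> leaves
    \<open>(int a0 - int b) * coeff (g b) m\<close>, and the first factor is a unit because
    \<open>A \<le> p\<close>.\<close>
  have ga: "int p dvd coeff (g b) i" if "b < A" "b \<noteq> a0" for b i
  proof (cases "w b \<le> i")
    case True
    then show ?thesis using Suc.prems(3) that by blast
  next
    case False
    then have "i \<le> w b" by simp
    then show ?thesis
    proof (induction rule: inc_induct)
      case base
      then show ?case using Suc.prems(3) that by blast
    next
      case (step m)
      have "int p dvd (int a0 - int b) * coeff (g b) m"
        using g'0[OF that(1), of m] step unfolding coeff_g' by (simp add: dvd_add_right_iff)
      moreover have "\<not> int p dvd int a0 - int b"
        using that a0 assms(1) by (intro nondvd_of_bounds) auto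
      ultimately show ?case by (rule dvd_prime_cancel[rotated])
    qed
  qed
  \<comment> \<open>Vanishing of the derivative of \<open>g a0\<close> controls the positive indices
    below \<open>p\<close>; from \<open>p\<close> on, the degree bound
    \<open>w a0 \<le> n \<le> p\<close> applies.\<close>
  have ga0: "int p dvd coeff (g a0) (Suc i)" for i
  proof (cases "Suc i < p")
    case True
    have "int p dvd int (Suc i) * coeff (g a0) (Suc i)"
      using g'0[OF a0(1), of i] unfolding coeff_g' by simp
    moreover have "\<not> int p dvd int (Suc i)" using True by (intro nondvd_of_bounds) auto
    ultimately show ?thesis by (rule dvd_prime_cancel[rotated])
  next
    case False
    have "w a0 \<le> (\<Sum>a<A. w a)" using a0 by (intro member_le_sum) auto
    then have "w a0 \<le> Suc i" using False Suc.prems by simp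
    then show ?thesis using Suc.prems(3) a0 by blast
  qed
  \<comment> \<open>As \<open>F\<close> has no constant term, the constant coefficient of
    \<open>H\<close> is the sum of those of all \<open>g a\<close>. This settles the one coefficient
    still open, that of \<open>g a0\<close> at 0.\<close>
  have comp0: "coeff (pcompose f F) 0 = coeff f 0" for f
    by (metis coeff_F_0 poly_0_coeff_0 poly_pcompose)
  have "int p dvd coeff H 0" using Suc.prems(4) n unfolding H_def by auto
  moreover have "coeff H 0 = (\<Sum>a<A. coeff (g a) 0)"
    unfolding H_def by (simp add: coeff_sum coeff_mult comp0 coeff_0_power coeff_F_0 poly_0_coeff_0)
  moreover have "(\<Sum>a<A. coeff (g a) 0) = coeff (g a0) 0 + (\<Sum>a\<in>{..<A} - {a0}. coeff (g a) 0)"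
    using a0 by (intro sum.remove) auto
  moreover have "int p dvd (\<Sum>a\<in>{..<A} - {a0}. coeff (g a) 0)"
    using ga by (intro dvd_sum) auto
  ultimately have "int p dvd coeff (g a0) 0" by (simp add: dvd_add_left_iff)
  then have "int p dvd coeff (g a0) i" for i using ga0 by (cases i) auto
  then show ?case using ga Suc.prems(5) by (cases "a = a0") auto
qed

text \<open>Stepanov's auxiliary polynomial with undetermined coefficients \<open>l\<close>. Powers
  of 1 - x are used because they are eigenfunctions of (1 - x) d/dx, the operator behind
  \<open>log_independence\<close>.\<close>

definition aux_poly :: "nat \<Rightarrow> nat \<Rightarrow> nat \<Rightarrow> (nat \<times> nat \<times> nat \<Rightarrow> int) \<Rightarrow> int poly" where
  "aux_poly A B C l = (\<Sum>c<C. [:0, 1:] ^ (p * c) *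
      (\<Sum>a<A. [:1, -1:] ^ a * (\<Sum>b<B. [:l (a, b, c):] * F ^ b)))"

lemma aux_poly_diff: "aux_poly A B C (\<lambda>x. l x - m x) = aux_poly A B C l - aux_poly A B C m"
proof -
  have e: "[:l x - m x:] = [:l x:] - [:m x:]" for x by simp
  show ?thesis unfolding aux_poly_def e
    by (simp only: left_diff_distrib right_diff_distrib sum_subtractf)
qed

lemma rep_aux_poly:
  assumes "0 < A" "0 < C"
  shows "rep (A + C - 2) (aux_poly A B C l)"
proof -
  have e: "aux_poly A B C l = (\<Sum>c<C. \<Sum>a<A. \<Sum>b<B. ([:1, -1:] ^ a * [:l (a, b, c):]) * F ^ b * [:0, 1:] ^ (p * c))"
    unfolding aux_poly_def by (simp only: sum_distrib_left sum_distrib_right mult_ac)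
  show ?thesis unfolding e
  proof (intro rep_sum rep_term)
    fix a b c assume "a \<in> {..<A}" "c \<in> {..<C}"
    moreover have "degree ([:1, -1:] ^ a * [:l (a, b, c):]) \<le> a"
      using degree_mult_le[of "[:1, -1:] ^ a" "[:l (a, b, c):]"] degree_power_le[of "[:1, -1 :: int:]" a]
      by (simp del: mult_pCons_right mult_pCons_left)
    ultimately show "degree ([:1, -1:] ^ a * [:l (a, b, c):]) + c \<le> A + C - 2"
      by simp
  qed
qed

lemma degree_aux_poly:
  assumes "A \<le> p" "0 < A" "0 < B" "0 < C"
  shows "degree (aux_poly A B C l) < p * (B + C)"
proof -
  have "degree (aux_poly A B C l) \<le> p * (C - 1) + ((A - 1) + p * (B - 1))"
    unfolding aux_poly_def
  proof (intro degree_sum_le finite_lessThan)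
    fix c assume c: "c \<in> {..<C}"
    let ?h = "\<Sum>a<A. [:1, -1:] ^ a * (\<Sum>b<B. [:l (a, b, c):] * F ^ b)"
    have "degree ?h \<le> (A - 1) + p * (B - 1)"
    proof (intro degree_sum_le finite_lessThan)
      fix a assume a: "a \<in> {..<A}"
      have "degree (\<Sum>b<B. [:l (a, b, c):] * F ^ b) \<le> p * (B - 1)"
      proof (intro degree_sum_le finite_lessThan)
        fix b assume b: "b \<in> {..<B}"
        have "degree ([:l (a, b, c):] * F ^ b) \<le> degree (F ^ b)"
          by (simp add: degree_smult_le)
        also have "\<dots> \<le> degree F * b" by (rule degree_power_le)
        also have "\<dots> \<le> p * (B - 1)" using degree_F b by (intro mult_le_mono) auto
        finally show "degree ([:l (a, b, c):] * F ^ b) \<le> p * (B - 1)" .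
      qed
      moreover have "degree ([:1, -1 :: int:] ^ a) \<le> A - 1"
        using degree_power_le[of "[:1, -1 :: int:]" a] a by simp
      ultimately show "degree ([:1, -1:] ^ a * (\<Sum>b<B. [:l (a, b, c):] * F ^ b)) \<le> (A - 1) + p * (B - 1)"
        by (rule order_trans[OF degree_mult_le add_mono[rotated]])
    qed
    moreover have "degree ([:0, 1 :: int:] ^ (p * c)) \<le> p * (C - 1)"
      using c by (auto simp: degree_linear_power)
    ultimately show "degree ([:0, 1:] ^ (p * c) * ?h) \<le> p * (C - 1) + ((A - 1) + p * (B - 1))"
      by (rule order_trans[OF degree_mult_le add_mono[rotated]])
  qed
  also have "\<dots> < p * (C - 1) + p + p * (B - 1)" using assms p_gt by simp
  also have "\<dots> \<le> p * (C - 1) + p + (p * (B - 1) + p)" by simp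
  also have "\<dots> = p * (B + C)" using assms by (cases B; cases C) (auto simp: algebra_simps)
  finally show ?thesis .
qed

lemma coeff_X_power_mult: "coeff ([:0, 1:] ^ n * (h :: int poly)) i = (if i < n then 0 else coeff h (i - n))"
  by (simp add: monom_altdef[symmetric, of 1, simplified] coeff_monom_mult)

text \<open>Induction on the block index \<open>c\<close>: lower blocks vanish modulo
  \<open>p\<close> and higher ones start in degree at least p (c + 1), so the first \<open>p\<close>
  coefficients of block \<open>c\<close> vanish. As \<open>A * B \<le> p\<close>,
  \<open>log_independence\<close> applies with \<open>n = p\<close> and all bounds \<open>w\<close>
  equal to \<open>B\<close>.\<close>

lemma aux_poly_pcong_0:
  assumes "A * B \<le> p" "A \<le> p" "pcong (aux_poly A B C l) 0" "a < A" "b < B" "c < C"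
  shows "int p dvd l (a, b, c)"
proof -
  define h where "h c = (\<Sum>a<A. [:1, -1:] ^ a * (\<Sum>b<B. [:l (a, b, c):] * F ^ b))" for c
  define g where "g c a = (\<Sum>b<B. [:l (a, b, c):] * [:0, 1:] ^ b)" for c a
  have pw: "pcompose ([:0, 1:] ^ b) F = F ^ b" for b
    by (induction b) (simp_all add: pcompose_mult pcompose_pCons pcompose_1 del: mult_pCons_left)
  have gF: "pcompose (g c a) F = (\<Sum>b<B. [:l (a, b, c):] * F ^ b)" for c a
    unfolding g_def by (simp add: pcompose_sum pcompose_smult pw)
  have gc: "coeff (g c a) i = (if i < B then l (a, i, c) else 0)" for c a i
    unfolding g_def
    by (simp add: coeff_sum monom_altdef[symmetric, of 1, simplified] if_distrib[of "(*) _"] cong: if_cong)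
  have "\<forall>a<A. \<forall>b<B. int p dvd l (a, b, c)" if "c < C" for c
    using that
  proof (induction c rule: less_induct)
    case (less c)
    have h0: "int p dvd coeff (h c') i" if "c' < c" for c' i
    proof -
      have "[:int p:] dvd [:l (a, b, c'):] * F ^ b" if "a < A" "b < B" for a b
        using less that \<open>c' < c\<close> by (simp add: const_poly_dvd_iff)
      then have "[:int p:] dvd h c'" unfolding h_def
        by (intro dvd_sum dvd_mult[of _ _ "[:1, -1:] ^ _"]) blast
      then show ?thesis by (simp add: const_poly_dvd_iff)
    qed
    have hc: "int p dvd coeff (h c) i" if "i < p" for i
    proof -
      have "int p dvd coeff (aux_poly A B C l) (p * c + i)"
        using assms(3) by (simp add: pcong_iff)
      also have "coeff (aux_poly A B C l) (p * c + i) =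
          (\<Sum>c'<C. coeff ([:0, 1:] ^ (p * c') * h c') (p * c + i))"
        unfolding aux_poly_def h_def by (rule coeff_sum)
      also have "\<dots> = coeff ([:0, 1:] ^ (p * c) * h c) (p * c + i) +
          (\<Sum>c'\<in>{..<C} - {c}. coeff ([:0, 1:] ^ (p * c') * h c') (p * c + i))"
        using less.prems by (intro sum.remove) auto
      finally have "int p dvd coeff (h c) i + (\<Sum>c'\<in>{..<C} - {c}. coeff ([:0, 1:] ^ (p * c') * h c') (p * c + i))"
        by (simp add: coeff_X_power_mult)
      moreover have "int p dvd (\<Sum>c'\<in>{..<C} - {c}. coeff ([:0, 1:] ^ (p * c') * h c') (p * c + i))"
      proof (intro dvd_sum)
        fix c' assume c': "c' \<in> {..<C} - {c}"
        show "int p dvd coeff ([:0, 1:] ^ (p * c') * h c') (p * c + i)"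
        proof (cases "c' < c")
          case True
          then show ?thesis by (simp add: coeff_X_power_mult h0)
        next
          case False
          then have "p * Suc c \<le> p * c'" using c' by (intro mult_le_mono) auto
          then have "p * c + i < p * c'" using that by simp
          then show ?thesis by (simp add: coeff_X_power_mult)
        qed
      qed
      ultimately show ?thesis by (simp add: dvd_add_left_iff)
    qed
    have "int p dvd coeff (g c a) b" if "a < A" for a b
    proof (rule log_independence[where w = "\<lambda>_. B" and n = p and g = "g c" and A = A])
      show "(\<Sum>a<A. B) \<le> p" using assms(1) by simp
      show "int p dvd coeff (\<Sum>a<A. [:1, -1:] ^ a * pcompose (g c a) F) i" if "i < p" for i
        using hc[OF that] unfolding h_def gF  .
    qed (use that assms gc in auto)
    then show ?case using gc by (metis (full_types))
  qed
  then show ?thesis using assms by blast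
qed

end

section \<open>The Stepanov bound for the level sets of the Fermat polynomial\<close>

context odd_prime
begin

text \<open>By the pigeonhole principle, two coefficient families agree in all conditions that make
  the first \<open>D\<close> derivatives vanish on \<open>S\<close>. If the conclusion failed, the
  degree of their difference would be below \<open>D * card S\<close>, so it would be zero modulo
  \<open>p\<close> and the families would coincide.\<close>

lemma stepanov:
  assumes "finite T" and "S \<subseteq> {2..<int p}"
    and cover: "\<And>a. a \<in> S \<Longrightarrow> \<exists>t\<in>T. [poly F a = t] (mod int p)"
    and pos: "0 < A" "0 < B" "0 < C"
    and "A * B \<le> p" "A \<le> p" "D \<le> p"
    and count: "card T * (D * (A + C + D)) < A * (B * C)"
  shows "D * card S < p * (B + C)"
proof (rule ccontr)
  assume contr: "\<not> D * card S < p * (B + C)"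
  define K where "K = A + C + D"
  define Box where "Box = {..<A} \<times> {..<B} \<times> {..<C}"
  define \<Lambda> where "\<Lambda> = (Box \<rightarrow>\<^sub>E {0..<int p})"
  define \<Psi> where "\<Psi> = aux_poly A B C"
  have "\<exists>Q. degree Q \<le> A + C - 2 + n \<and> (\<forall>a. [poly F a = t] (mod int p) \<longrightarrow>
      [poly ((\<theta> ^^ n) (\<Psi> l)) a = poly Q a] (mod int p))" for l n t
    using pos unfolding \<Psi>_def by (intro rep_eval rep_\<theta>_iter rep_aux_poly)
  then have "\<forall>l n t. \<exists>Q. degree Q \<le> A + C - 2 + n \<and> (\<forall>a. [poly F a = t] (mod int p) \<longrightarrow>
      [poly ((\<theta> ^^ n) (\<Psi> l)) a = poly Q a] (mod int p))" by blast
  then obtain Q where Q': "\<forall>l n t. degree (Q l n t) \<le> A + C - 2 + n \<and>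
      (\<forall>a. [poly F a = t] (mod int p) \<longrightarrow>
        [poly ((\<theta> ^^ n) (\<Psi> l)) a = poly (Q l n t) a] (mod int p))"
    unfolding choice_iff by blast
  have Q: "degree (Q l n t) \<le> A + C - 2 + n"
      "[poly F a = t] (mod int p) \<Longrightarrow>
        [poly ((\<theta> ^^ n) (\<Psi> l)) a = poly (Q l n t) a] (mod int p)" for l n t a
    using Q' by blast+
  define Idx where "Idx = T \<times> {..<D} \<times> {..<K}"
  \<comment> \<open>Since \<open>K\<close> exceeds \<open>A + C - 2 + n\<close> for every
    \<open>n < D\<close>, the signature records all coefficients of each \<open>Q l n t\<close>
    modulo \<open>p\<close>.\<close>
  define sig where "sig l = (\<lambda>(t, n, i)\<in>Idx. coeff (Q l n t) i mod int p)" for l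
  have fin: "finite Idx" "finite Box" using assms(1) by (auto simp: Idx_def Box_def)
  have "sig ` \<Lambda> \<subseteq> (Idx \<rightarrow>\<^sub>E {0..<int p})"
    using p_gt by (auto simp: sig_def)
  then have "card (sig ` \<Lambda>) \<le> card (Idx \<rightarrow>\<^sub>E {0..<int p})"
    using fin by (intro card_mono finite_PiE) auto
  also have "\<dots> = p ^ (card T * (D * K))"
    using fin by (simp add: card_PiE Idx_def card_cartesian_product)
  also have "\<dots> < p ^ (A * (B * C))"
    using count p_gt unfolding K_def by (intro power_strict_increasing) auto
  also have "\<dots> = card \<Lambda>"
    unfolding \<Lambda>_def using fin by (simp add: card_PiE Box_def card_cartesian_product)
  finally have "\<not> inj_on sig \<Lambda>" by (rule pigeonhole)
  then obtain l m where lm: "l \<in> \<Lambda>" "m \<in> \<Lambda>" "sig l = sig m" "l \<noteq> m"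
    unfolding inj_on_def by blast
  have QQ: "pcong (Q l n t) (Q m n t)" if "t \<in> T" "n < D" for n t
    unfolding pcong_iff
  proof
    fix i
    show "int p dvd coeff (Q l n t) i - coeff (Q m n t) i"
    proof (cases "i < K")
      case True
      then have "sig l (t, n, i) = sig m (t, n, i)" "(t, n, i) \<in> Idx"
        using that lm by (auto simp: Idx_def)
      then show ?thesis by (simp add: sig_def mod_eq_dvd_iff)
    next
      case False
      then have "A + C - 2 + n < i" using that pos by (simp add: K_def)
      then have "coeff (Q l n t) i = 0" "coeff (Q m n t) i = 0"
        using Q(1) by (auto intro!: coeff_eq_0 le_less_trans[OF Q(1)])
      then show ?thesis by simp
    qed
  qed
  define h where "h = \<Psi> l - \<Psi> m"
  have h: "h = aux_poly A B C (\<lambda>x. l x - m x)" unfolding h_def \<Psi>_def aux_poly_diff ..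
  have "pcong h 0"
  proof (rule vanish_imp_pcong_0)
    show "finite S" using assms(2) finite_subset by blast
    show "1 < a \<and> a < int p" if "a \<in> S" for a using that assms(2) by auto
    show "degree h < D * card S"
      using degree_aux_poly[OF \<open>A \<le> p\<close> pos] contr unfolding h by (meson less_le_trans not_less)
    show "int p dvd poly ((\<theta> ^^ n) h) a" if a: "a \<in> S" "n < D" for a n
    proof -
      obtain t where t: "t \<in> T" "[poly F a = t] (mod int p)" using cover a by blast
      have "[poly ((\<theta> ^^ n) h) a = poly (Q l n t) a - poly (Q m n t) a] (mod int p)"
        unfolding h_def \<theta>_iter_diff poly_diff by (intro cong_diff Q(2) t)
      moreover have "[poly (Q l n t) a = poly (Q m n t) a] (mod int p)"
        using QQ t a by (intro pcong_poly) auto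
      ultimately show ?thesis by (metis cong_0_iff cong_diff_iff_cong_0 cong_trans)
    qed
  qed fact
  have "l x = m x" if xBox: "x \<in> Box" for x
  proof -
    obtain a b c where x: "x = (a, b, c)" "a < A" "b < B" "c < C"
      using xBox by (cases x) (auto simp: Box_def)
    have "int p dvd l x - m x"
      using aux_poly_pcong_0[OF \<open>A * B \<le> p\<close> \<open>A \<le> p\<close> \<open>pcong h 0\<close>[unfolded h] x(2-4)] x(1) by simp
    then have "l x mod int p = m x mod int p" by (simp add: mod_eq_dvd_iff)
    then show ?thesis using lm(1,2) xBox unfolding \<Lambda>_def
      by (metis PiE_mem atLeastLessThan_iff mod_pos_pos_trivial)
  qed
  then have "l = m" using lm(1,2) unfolding \<Lambda>_def by (intro PiE_ext) auto
  with lm show False by simp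
qed

section \<open>Fibre sizes of the truncated logarithm and their third moment\<close>

definition R :: "int \<Rightarrow> nat" where
  "R t = card {a \<in> {2..<int p}. [poly F a = t] (mod int p)}"

lemma sum_R:
  assumes "T \<subseteq> {0..<int p}"
  shows "(\<Sum>t\<in>T. R t) = card {a \<in> {2..<int p}. poly F a mod int p \<in> T}"
proof -
  have fin: "finite T" using assms finite_subset by blast
  have mod: "[x = t] (mod int p) \<longleftrightarrow> x mod int p = t" if "t \<in> T" for x t
  proof -
    have "t mod int p = t" using that assms by (auto intro!: mod_pos_pos_trivial)
    then show ?thesis by (simp add: Cong.cong_def)
  qed
  have eq: "{a \<in> {2..<int p}. poly F a mod int p \<in> T} =
      (\<Union>t\<in>T. {a \<in> {2..<int p}. [poly F a = t] (mod int p)})"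
    by (auto simp: mod)
  have "card (\<Union>t\<in>T. {a \<in> {2..<int p}. [poly F a = t] (mod int p)}) =
      (\<Sum>t\<in>T. card {a \<in> {2..<int p}. [poly F a = t] (mod int p)})"
  proof (intro card_UN_disjoint fin ballI impI)
    fix s t assume "s \<in> T" "t \<in> T" "s \<noteq> t"
    then show "{a \<in> {2..<int p}. [poly F a = s] (mod int p)} \<inter>
        {a \<in> {2..<int p}. [poly F a = t] (mod int p)} = {}"
      by (auto simp: mod)
  qed (rule finite_subset[of _ "{2..<int p}"], auto)
  then show ?thesis unfolding eq R_def by simp
qed

lemma sum_R_le:
  assumes "T \<subseteq> {0..<int p}"
  shows "(\<Sum>t\<in>T. R t) \<le> p"
proof -
  have "card {a \<in> {2..<int p}. poly F a mod int p \<in> T} \<le> card {2..<int p}"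
    by (intro card_mono) auto
  then show ?thesis unfolding sum_R[OF assms] by simp
qed

text \<open>Stepanov gives D J s < 2 p B, hence J s is at most 2 p^2 / D^2. With \<open>D\<close> of
  order (p^2 / J)^(1/3), cubing this yields the bound; 86528 is 8 * 104^2.\<close>

lemma level_small:
  assumes T: "T \<subseteq> {0..<int p}" and J: "card T = J" "0 < J" and small: "(104 * J)\<^sup>2 \<le> p"
    and s: "\<And>t. t \<in> T \<Longrightarrow> s \<le> R t"
  shows "J * s ^ 3 \<le> 86528 * p\<^sup>2"
proof -
  have finT: "finite T" using T finite_subset by blast
  \<comment> \<open>The largest such \<open>D\<close> is taken. The factor 13 exceeds the 12 = 3 * 4
    used in \<open>cnt\<close>; maximality costs a factor 2^3 and leads to 104 = 13 * 8.\<close>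
  define P where "P D \<longleftrightarrow> 13 * J * D ^ 3 \<le> p\<^sup>2" for D
  have bnd: "D \<le> p" if "P D" for D
  proof (rule ccontr)
    assume "\<not> D \<le> p"
    then have "p ^ 3 < D ^ 3" by (intro power_strict_mono) auto
    also have "\<dots> \<le> 13 * J * D ^ 3" using J by simp
    also have "\<dots> \<le> p\<^sup>2" using that by (simp add: P_def)
    finally show False using p_gt by (simp add: power_less_imp_less_exp)
  qed
  have "13 * J \<le> (104 * J)\<^sup>2" using J by (simp add: power2_eq_square)
  also have "\<dots> \<le> p" by fact
  also have "\<dots> \<le> p\<^sup>2" by (simp add: power2_eq_square)
  finally have P1: "P 1" by (simp add: P_def)
  define D where "D = (GREATEST D. P D)"
  have PD: "P D" unfolding D_def using P1 bnd by (rule GreatestI_nat)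
  have D1: "1 \<le> D" unfolding D_def using P1 bnd by (rule Greatest_le_nat)
  have "\<not> P (Suc D)"
  proof
    assume "P (Suc D)"
    then have "Suc D \<le> D" unfolding D_def using bnd by (rule Greatest_le_nat)
    then show False by simp
  qed
  then have "p\<^sup>2 < 13 * J * Suc D ^ 3" by (simp add: P_def)
  also have "\<dots> \<le> 13 * J * (2 * D) ^ 3" using D1 by (intro mult_le_mono power_mono) auto
  also have "\<dots> = 104 * J * D ^ 3" by (simp add: power_mult_distrib)
  finally have lower: "p\<^sup>2 < 104 * J * D ^ 3" .
  have "(p\<^sup>2)\<^sup>2 < (104 * J * D ^ 3)\<^sup>2" using lower by (intro power_strict_mono) auto
  then have lower2: "p ^ 4 < (104 * J)\<^sup>2 * D ^ 6" by (simp add: power_mult_distrib)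
  have Dp: "D \<le> p" using bnd PD by blast
  \<comment> \<open>This is where the smallness of \<open>J\<close> enters; it makes
    \<open>B\<close> at most \<open>D\<close>.\<close>
  have Dsq: "p \<le> D\<^sup>2"
  proof (rule ccontr)
    assume "\<not> p \<le> D\<^sup>2"
    then have "(D\<^sup>2) ^ 3 \<le> p ^ 3" by (intro power_mono) auto
    then have "D ^ 6 \<le> p ^ 3" by simp
    then have "(104 * J)\<^sup>2 * D ^ 6 \<le> p * p ^ 3" using small by (intro mult_le_mono)
    also have "\<dots> = p ^ 4" by (simp add: eval_nat_numeral)
    finally show False using lower2 by simp
  qed
  define B where "B = p div D"
  have B1: "0 < B" using Dp D1 by (simp add: B_def div_greater_zero_iff)
  have BD: "D * B \<le> p" by (simp add: B_def)
  have BlD: "B \<le> D"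
  proof -
    have "p div D \<le> D\<^sup>2 div D" using Dsq by (rule div_le_mono)
    then show ?thesis using D1 by (simp add: B_def power2_eq_square)
  qed
  have "p < D * (B + 1)"
    unfolding B_def using D1 dividend_less_times_div[of D p] by (simp add: algebra_simps)
  also have "\<dots> \<le> D * (2 * B)" using B1 by (intro mult_le_mono) auto
  finally have pB: "p < 2 * D * B" by simp
  have cnt: "J * (D * (D + B + D)) < D * (B * B)"
  proof -
    have "12 * J * D ^ 3 \<le> 13 * J * D ^ 3" by simp
    also have "\<dots> \<le> p\<^sup>2" using PD by (simp add: P_def)
    also have "\<dots> < (2 * D * B)\<^sup>2" using pB by (intro power_strict_mono) auto
    finally have "4 * D\<^sup>2 * (3 * J * D) < 4 * D\<^sup>2 * (B * B)"
      by (simp add: power_mult_distrib eval_nat_numeral algebra_simps)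
    then have "3 * J * D < B * B" by (simp add: mult_ac)
    then have "D * (3 * J * D) < D * (B * B)" using D1 by simp
    moreover have "J * (D * (D + B + D)) \<le> J * (D * (3 * D))"
      using BlD by (intro mult_le_mono) auto
    moreover have "J * (D * (3 * D)) = D * (3 * J * D)" by (simp only: mult_ac)
    ultimately show ?thesis by linarith
  qed
  define S where "S = {a \<in> {2..<int p}. poly F a mod int p \<in> T}"
  \<comment> \<open>Stepanov's parameters are \<open>A = D\<close> and \<open>C = B\<close>.\<close>
  have "D * card S < p * (B + B)"
  proof (rule stepanov[OF finT])
    show "\<exists>t\<in>T. [poly F a = t] (mod int p)" if "a \<in> S" for a
      using that by (intro bexI[of _ "poly F a mod int p"]) (auto simp: S_def Cong.cong_def)
    show "card T * (D * (D + B + D)) < D * (B * B)" using cnt J by simp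
  qed (use D1 B1 BD Dp in \<open>auto simp: S_def\<close>)
  moreover have "J * s \<le> card S"
  proof -
    have "J * s = (\<Sum>t\<in>T. s)" using J by simp
    also have "\<dots> \<le> (\<Sum>t\<in>T. R t)" using s by (intro sum_mono)
    finally show ?thesis unfolding sum_R[OF T] S_def .
  qed
  ultimately have "D * (J * s) \<le> 2 * p * B"
    by (metis (no_types, lifting) less_imp_le_nat mult_2 mult.assoc mult.left_commute mult_le_mono2 order_trans)
  then have "D * (D * (J * s)) \<le> D * (2 * p * B)" by (rule mult_le_mono2)
  also have "\<dots> = 2 * p * (D * B)" by simp
  also have "\<dots> \<le> 2 * p * p" using BD by (intro mult_le_mono2)
  finally have "(D * (D * (J * s))) ^ 3 \<le> (2 * p * p) ^ 3" by (rule power_mono) simp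
  then have c3: "D ^ 6 * (J ^ 3 * s ^ 3) \<le> 8 * p ^ 6"
    by (simp add: power_mult_distrib eval_nat_numeral algebra_simps)
  have "p ^ 4 * (J * s ^ 3) \<le> ((104 * J)\<^sup>2 * D ^ 6) * (J * s ^ 3)"
    using lower2 by (intro mult_le_mono1) simp
  also have "\<dots> = 10816 * (D ^ 6 * (J ^ 3 * s ^ 3))"
    by (simp add: power_mult_distrib power3_eq_cube power2_eq_square mult_ac)
  also have "\<dots> \<le> 10816 * (8 * p ^ 6)" using c3 by (rule mult_le_mono2)
  also have "\<dots> = p ^ 4 * (86528 * p\<^sup>2)" by (simp add: power_add[symmetric])
  finally show ?thesis using p_gt by simp
qed

text \<open>When s^2 is at most 86528 p, the trivial bound \<open>card T * s \<le> p\<close>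
  suffices. When \<open>T\<close> is too large for \<open>level_small\<close>, either
  \<open>p < 86528\<close> and \<open>s \<le> p\<close>, or \<open>level_small\<close> is applied to
  a subset of the largest admissible size; in both cases s^2 is at most 86528 p.\<close>

lemma level_bound: "card {t \<in> {0..<int p}. s \<le> R t} * s ^ 3 \<le> 86528 * p\<^sup>2"
proof -
  define T where "T = {t \<in> {0..<int p}. s \<le> R t}"
  have T: "T \<subseteq> {0..<int p}" by (auto simp: T_def)
  have "card T * s = (\<Sum>t\<in>T. s)" by simp
  also have "\<dots> \<le> (\<Sum>t\<in>T. R t)" by (intro sum_mono) (simp add: T_def)
  also have "\<dots> \<le> p" using T by (rule sum_R_le)
  finally have Ts: "card T * s \<le> p" .
  have bound_sq: "card T * s ^ 3 \<le> 86528 * p\<^sup>2" if "s\<^sup>2 \<le> 86528 * p"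
  proof -
    have "card T * s ^ 3 = (card T * s) * s\<^sup>2" by (simp add: eval_nat_numeral)
    also have "\<dots> \<le> p * (86528 * p)" using Ts that by (intro mult_le_mono)
    finally show ?thesis by (simp add: power2_eq_square)
  qed
  show ?thesis
  proof (cases "card T = 0 \<or> s = 0 \<or> (104 * card T)\<^sup>2 \<le> p")
    case True
    moreover have "card T * s ^ 3 \<le> 86528 * p\<^sup>2" if "card T \<noteq> 0" "(104 * card T)\<^sup>2 \<le> p"
      using that by (intro level_small[OF T refl]) (auto simp: T_def)
    ultimately have "card T * s ^ 3 \<le> 86528 * p\<^sup>2" by (cases "card T = 0"; cases "s = 0") simp_all
    then show ?thesis unfolding T_def .
  next
    case False
    have "1 * s \<le> card T * s" using False by (intro mult_le_mono1) linarith
    then have "s \<le> p" using Ts by linarith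
    show ?thesis
    proof (cases "p < 86528")
      case True
      have "s\<^sup>2 \<le> p * p" using \<open>s \<le> p\<close> by (simp add: power2_eq_square mult_le_mono)
      also have "\<dots> \<le> 86528 * p" using True by simp
      finally show ?thesis using bound_sq unfolding T_def by simp
    next
      case big: False
      define P where "P J \<longleftrightarrow> (104 * J)\<^sup>2 \<le> p" for J
      have bnd: "J \<le> card T" if "P J" for J
      proof (rule ccontr)
        assume "\<not> J \<le> card T"
        then have "(104 * card T)\<^sup>2 \<le> (104 * J)\<^sup>2" by (intro power_mono) auto
        then have "(104 * card T)\<^sup>2 \<le> p" using that unfolding P_def by (rule order_trans)
        then show False using False by blast
      qed
      have P1: "P 1" using big by (simp add: P_def)
      define J where "J = (GREATEST J. P J)"
      have PJ: "P J" unfolding J_def using P1 bnd by (rule GreatestI_nat)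
      have J1: "1 \<le> J" unfolding J_def using P1 bnd by (rule Greatest_le_nat)
      have "\<not> P (Suc J)"
      proof
        assume "P (Suc J)"
        then have "Suc J \<le> J" unfolding J_def using bnd by (rule Greatest_le_nat)
        then show False by simp
      qed
      then have "p < (104 * Suc J)\<^sup>2" by (simp add: P_def)
      also have "\<dots> \<le> (208 * J)\<^sup>2" using J1 by (intro power_mono) auto
      finally have pJ: "p < (208 * J)\<^sup>2" .
      obtain T' where T': "T' \<subseteq> T" "card T' = J"
        using obtain_subset_with_card_n[OF bnd[OF PJ]] by metis
      have "J * s ^ 3 \<le> 86528 * p\<^sup>2"
        using T' T PJ J1 by (intro level_small[of T']) (auto simp: P_def T_def)
      then have "(J * s ^ 3)\<^sup>2 \<le> (86528 * p\<^sup>2)\<^sup>2" by (rule power_mono) simp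
      then have e: "J\<^sup>2 * s ^ 6 \<le> 86528\<^sup>2 * p ^ 4" by (simp add: power_mult_distrib)
      have "p * s ^ 6 \<le> (208 * J)\<^sup>2 * s ^ 6" using pJ by (intro mult_le_mono1) simp
      also have "\<dots> = 208\<^sup>2 * (J\<^sup>2 * s ^ 6)" by (simp add: power_mult_distrib)
      also have "\<dots> \<le> 208\<^sup>2 * (86528\<^sup>2 * p ^ 4)" using e by (rule mult_le_mono2)
      \<comment> \<open>Here 208^2 is half of 86528.\<close>
      also have "\<dots> \<le> p * (86528 * p) ^ 3" 
      proof -
        have "p * (k * p) ^ 3 = k ^ 3 * p ^ 4" for k by (simp add: eval_nat_numeral)
        from this[of 86528] show ?thesis by simp
      qed
      finally have "(s\<^sup>2) ^ 3 \<le> (86528 * p) ^ 3" using p_gt by simp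
      then have "s\<^sup>2 \<le> 86528 * p" 
        using power_mono_iff[of "s\<^sup>2" "86528 * p" 3] by simp
      then show ?thesis using bound_sq unfolding T_def by simp
    qed
  qed
qed

text \<open>Summation over levels: \<open>level_bound\<close> turns the weight 3 s^2 into 3 * 86528
  p^2 / s, and the harmonic sum produces the logarithm.\<close>

lemma sum_R_cubed: "real (\<Sum>t\<in>{0..<int p}. R t ^ 3) \<le> 259584 * real p ^ 2 * (1 + ln (real p))"
proof -
  have cube: "n ^ 3 \<le> (\<Sum>s=1..n. 3 * s\<^sup>2)" for n :: nat
  proof (induction n)
    case (Suc n)
    have "Suc n ^ 3 \<le> n ^ 3 + 3 * (Suc n)\<^sup>2" by (simp add: eval_nat_numeral algebra_simps)
    then show ?case using Suc by simp
  qed simp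
  have Rp: "R t \<le> p" if "t \<in> {0..<int p}" for t
    using sum_R_le[of "{t}"] that by simp
  have "(\<Sum>t\<in>{0..<int p}. R t ^ 3) \<le> (\<Sum>t\<in>{0..<int p}. \<Sum>s=1..p. if s \<le> R t then 3 * s\<^sup>2 else 0)"
  proof (intro sum_mono)
    fix t assume t: "t \<in> {0..<int p}"
    have "(\<Sum>s=1..R t. 3 * s\<^sup>2) = (\<Sum>s=1..p. if s \<le> R t then 3 * s\<^sup>2 else 0)"
      using Rp[OF t] by (intro sum.mono_neutral_cong_left) auto
    then show "R t ^ 3 \<le> (\<Sum>s=1..p. if s \<le> R t then 3 * s\<^sup>2 else 0)" using cube by metis
  qed
  also have "\<dots> = (\<Sum>s=1..p. \<Sum>t\<in>{0..<int p}. if s \<le> R t then 3 * s\<^sup>2 else 0)"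
    by (rule sum.swap)
  also have "\<dots> = (\<Sum>s=1..p. card {t \<in> {0..<int p}. s \<le> R t} * (3 * s\<^sup>2))"
    by (intro sum.cong refl) (simp add: sum.If_cases Int_def)
  finally have "real (\<Sum>t\<in>{0..<int p}. R t ^ 3) \<le>
     real (\<Sum>s=1..p. card {t \<in> {0..<int p}. s \<le> R t} * (3 * s\<^sup>2))"
    by (rule of_nat_mono)
  also have "\<dots> \<le> (\<Sum>s=1..p. 259584 * real p ^ 2 * (1 / real s))"
    unfolding of_nat_sum
  proof (intro sum_mono)
    fix s assume s: "s \<in> {1..p}"
    have "real (card {t \<in> {0..<int p}. s \<le> R t}) * real s ^ 3 \<le> 86528 * real p ^ 2"
      using of_nat_mono[OF level_bound[of s], where ?'a = real] by simp
    then show "real (card {t \<in> {0..<int p}. s \<le> R t} * (3 * s\<^sup>2)) \<le> 259584 * real p ^ 2 * (1 / real s)"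
      using s by (simp add: field_simps power3_eq_cube power2_eq_square)
  qed
  also have "\<dots> = 259584 * real p ^ 2 * (\<Sum>s=1..p. 1 / real s)"
    by (simp only: sum_distrib_left)
  also have "(\<Sum>s=1..n. 1 / real s) \<le> 1 + ln (real n)" if "n > 0" for n
    using that
  proof (induction n rule: nat_induct_non_zero)
    case (Suc n)
    have "1 / real (Suc n) \<le> ln (real (Suc n)) - ln (real n)"
    proof -
      have "ln (real n / real (Suc n)) \<le> real n / real (Suc n) - 1"
        using Suc by (intro ln_le_minus_one) simp
      then show ?thesis using Suc by (simp add: ln_div field_simps)
    qed
    then show ?case using Suc by simp
  qed simp
  finally show ?thesis using p_gt by simp
qed

end

section \<open>Third moment energy of the subgroup of p-th powers\<close>

text \<open>Both factors of a^p - b^p = (a - b) (a^(p-1) + ... + b^(p-1)) are divisible by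
  \<open>p\<close>. So p-th powers modulo p^2 depend only on residues modulo
  \<open>p\<close>.\<close>

lemma cong_power_prime_square:
  fixes a b :: int
  assumes "[a = b] (mod int p)"
  shows "[a ^ p = b ^ p] (mod int p ^ 2)"
proof -
  have "int p dvd (\<Sum>i<p. b ^ (p - Suc i) * a ^ i)"
  proof -
    have "[(\<Sum>i<p. b ^ (p - Suc i) * a ^ i) = (\<Sum>i<p. b ^ (p - Suc i) * b ^ i)] (mod int p)"
      by (intro cong_sum cong_mult cong_pow assms cong_refl)
    also have "(\<Sum>i<p. b ^ (p - Suc i) * b ^ i) = (\<Sum>i<p. b ^ (p - 1))"
      by (intro sum.cong) (auto simp: power_add[symmetric])
    also have "[(\<Sum>i<p. b ^ (p - 1)) = 0] (mod int p)"
      by (simp add: cong_0_iff)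
    finally show ?thesis by (simp add: cong_0_iff)
  qed
  moreover have "int p dvd a - b" using assms by (simp add: cong_iff_dvd_diff)
  ultimately have "int p * int p dvd (a - b) * (\<Sum>i<p. b ^ (p - Suc i) * a ^ i)"
    by (rule mult_dvd_mono[rotated])
  then show ?thesis
    by (simp only: cong_iff_dvd_diff power2_eq_square power_diff_sumr2)
qed

context odd_prime
begin

text \<open>Index set of the subgroup of p-th powers modulo p^2: as x^p = x modulo \<open>p\<close>,
  each element is x^p for exactly one \<open>x\<close> here.\<close>

definition X :: "int set" where "X = {1..<int p}"

definition pdiff :: "int \<times> int \<Rightarrow> int" where "pdiff P = fst P ^ p - snd P ^ p"

text \<open>The third moment of the number of representations of a residue as a difference of two
  elements of the subgroup.\<close>

definition energy3 :: nat where
  "energy3 = card {(P, Q, S). P \<in> X \<times> X \<and> Q \<in> X \<times> X \<and> S \<in> X \<times> X \<and>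
     [pdiff P = pdiff Q] (mod int p ^ 2) \<and> [pdiff P = pdiff S] (mod int p ^ 2)}"

lemma finite_X [simp]: "finite X"
  by (simp add: X_def)

lemma card_X: "card X = p - 1"
  by (simp add: X_def)

lemma X_not_dvd: "x \<in> X \<Longrightarrow> \<not> int p dvd x"
  unfolding X_def by (intro nondvd_of_bounds) auto

lemma X_mod: "x \<in> X \<Longrightarrow> x mod int p = x"
  by (simp add: X_def)

lemma mod_in_X: "\<not> int p dvd n \<Longrightarrow> n mod int p \<in> X"
proof -
  assume "\<not> int p dvd n"
  then have "n mod int p \<noteq> 0" by (simp add: dvd_eq_mod_eq_0)
  moreover have "0 \<le> n mod int p" "n mod int p < int p" using p_gt by simp_all
  ultimately have "1 \<le> n mod int p" by linarith
  then show ?thesis using \<open>n mod int p < int p\<close> by (simp add: X_def)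
qed

lemma X_cong_imp_eq: "x \<in> X \<Longrightarrow> y \<in> X \<Longrightarrow> [x = y] (mod int p) \<Longrightarrow> x = y"
  unfolding Cong.cong_def by (simp add: X_mod)

lemma cong_p_of_square: "[a = b] (mod int p ^ 2) \<Longrightarrow> [a = b] (mod int p)"
  by (rule cong_dvd_modulus) auto

lemma pdiff_cong_p: "[pdiff P = fst P - snd P] (mod int p)"
  unfolding pdiff_def by (intro cong_diff fermat_int)

text \<open>Pairs with difference \<open>w\<close> modulo \<open>p\<close>, normalized to difference
  1 by the factor \<open>w\<close>.\<close>

definition dilate :: "int \<Rightarrow> int \<Rightarrow> int \<times> int" where
  "dilate w a = (w * a mod int p, w * (a - 1) mod int p)"

lemma pdiff_dilate: "[pdiff (dilate w a) = w ^ p * (1 - int p * poly F a)] (mod int p ^ 2)"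
proof -
  have "[pdiff (dilate w a) = (w * a) ^ p - (w * (a - 1)) ^ p] (mod int p ^ 2)"
    unfolding pdiff_def dilate_def
    by (intro cong_diff) (auto intro!: cong_power_prime_square)
  also have "(w * a) ^ p - (w * (a - 1)) ^ p = w ^ p * (1 - int p * poly F a)"
  proof -
    have "1 - int p * poly F a = a ^ p - (a - 1) ^ p" by (simp add: poly_F)
    then show ?thesis unfolding power_mult_distrib by (simp only: right_diff_distrib[symmetric])
  qed
  finally show ?thesis .
qed

text \<open>Take \<open>a\<close> to be the first entry divided by \<open>w\<close>. It is neither 0
  nor 1 modulo \<open>p\<close>, because neither entry of the pair is 0.\<close>

lemma offdiag_pair:
  assumes "P \<in> X \<times> X" "w \<in> X" "[fst P - snd P = w] (mod int p)"
  shows "\<exists>a\<in>{2..<int p}. P = dilate w a"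
proof -
  obtain x y where P: "P = (x, y)" "x \<in> X" "y \<in> X" using assms(1) by auto
  have "coprime w (int p)"
    using X_not_dvd[OF assms(2)] prime_int by (metis coprime_commute prime_imp_coprime)
  then obtain v where v: "[w * v = 1] (mod int p)" using cong_solve_coprime_int by blast
  define a where "a = x * v mod int p"
  have wa: "[w * a = x] (mod int p)"
  proof -
    have "[w * a = w * (x * v)] (mod int p)" unfolding a_def by (intro cong_mult cong_refl) simp
    also have "w * (x * v) = x * (w * v)" by simp
    also have "[\<dots> = x * 1] (mod int p)" by (intro cong_mult cong_refl v)
    finally show ?thesis by simp
  qed
  have wa1: "[w * (a - 1) = y] (mod int p)"
  proof -
    have "[w * a - w = x - (x - y)] (mod int p)"
      using assms(3) P by (intro cong_diff wa) (simp add: cong_sym)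
    then show ?thesis by (simp add: algebra_simps)
  qed
  have "P = dilate w a"
    using wa wa1 X_mod P unfolding dilate_def Cong.cong_def by simp
  moreover have "a \<in> {2..<int p}"
  proof -
    have "0 \<le> a" "a < int p" using p_gt by (auto simp: a_def)
    moreover have "a \<noteq> 0" using wa X_not_dvd[OF P(2)] by (auto simp: cong_0_iff dest: cong_sym)
    moreover have "a \<noteq> 1" using wa1 X_not_dvd[OF P(3)] by (auto simp: cong_0_iff dest: cong_sym)
    ultimately show ?thesis by auto
  qed
  ultimately show ?thesis by blast
qed

text \<open>The three pairs share their difference \<open>w\<close> modulo \<open>p\<close>. If it
  is 0, all are diagonal, which gives at most p^3 triples. Otherwise they are dilates by
  \<open>w\<close> of parameters at which \<open>F\<close> takes the same value modulo
  \<open>p\<close>.\<close>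

lemma energy3_le: "energy3 \<le> p ^ 3 + p * (\<Sum>t\<in>{0..<int p}. R t ^ 3)"
proof -
  define fib where "fib t = {a \<in> {2..<int p}. [poly F a = t] (mod int p)}" for t
  have fin_fib: "finite (fib t)" for t
    unfolding fib_def by (rule finite_subset[of _ "{2..<int p}"]) auto
  define V where "V = (\<Union>t\<in>{0..<int p}. fib t \<times> fib t \<times> fib t)"
  define Diag where "Diag = (\<lambda>(x, y, z). ((x, x), (y, y), (z, z))) ` (X \<times> X \<times> X)"
  define Off where "Off = (\<lambda>(w, a, b, c). (dilate w a, dilate w b, dilate w c)) ` (X \<times> V)"
  have finV: "finite V" unfolding V_def using fin_fib by auto
  have cardV: "card V \<le> (\<Sum>t\<in>{0..<int p}. R t ^ 3)"
  proof -
    have "card V \<le> (\<Sum>t\<in>{0..<int p}. card (fib t \<times> fib t \<times> fib t))"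
      unfolding V_def by (intro card_UN_le) simp
    also have "\<dots> = (\<Sum>t\<in>{0..<int p}. R t ^ 3)"
      by (intro sum.cong refl) (simp add: card_cartesian_product R_def fib_def power3_eq_cube)
    finally show ?thesis .
  qed
  have "{(P, Q, S). P \<in> X \<times> X \<and> Q \<in> X \<times> X \<and> S \<in> X \<times> X \<and>
     [pdiff P = pdiff Q] (mod int p ^ 2) \<and> [pdiff P = pdiff S] (mod int p ^ 2)} \<subseteq> Diag \<union> Off"
  proof clarify
    fix x x' y y' z z'
    assume mem: "x \<in> X" "x' \<in> X" "y \<in> X" "y' \<in> X" "z \<in> X" "z' \<in> X"
      and e1: "[pdiff (x, x') = pdiff (y, y')] (mod int p ^ 2)"
      and e2: "[pdiff (x, x') = pdiff (z, z')] (mod int p ^ 2)"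
      and noff: "((x, x'), (y, y'), (z, z')) \<notin> Off"
    have d1: "[x - x' = y - y'] (mod int p)"
      using pdiff_cong_p[of "(x, x')"] pdiff_cong_p[of "(y, y')"] cong_p_of_square[OF e1]
      by (metis cong_sym cong_trans fst_conv snd_conv)
    have d2: "[x - x' = z - z'] (mod int p)"
      using pdiff_cong_p[of "(x, x')"] pdiff_cong_p[of "(z, z')"] cong_p_of_square[OF e2]
      by (metis cong_sym cong_trans fst_conv snd_conv)
    show "((x, x'), (y, y'), (z, z')) \<in> Diag"
    proof (cases "x = x'")
      case True
      then have "[y = y'] (mod int p)" "[z = z'] (mod int p)"
        using d1 d2 by (auto simp: cong_iff_dvd_diff dvd_diff_commute)
      then have "y = y'" "z = z'" using mem X_cong_imp_eq by auto
      then show ?thesis using True mem unfolding Diag_def by (intro image_eqI[of _ _ "(x, y, z)"]) auto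
    next
      case False
      define w where "w = (x - x') mod int p"
      have "\<not> int p dvd x - x'" using False X_cong_imp_eq mem by (auto simp: cong_iff_dvd_diff)
      then have w: "w \<in> X" unfolding w_def by (rule mod_in_X)
      have ww: "[x - x' = w] (mod int p)" by (simp add: w_def Cong.cong_def)
      obtain a where a: "a \<in> {2..<int p}" "(x, x') = dilate w a"
        using offdiag_pair[of "(x, x')" w] mem w ww by auto
      obtain b where b: "b \<in> {2..<int p}" "(y, y') = dilate w b"
        using offdiag_pair[of "(y, y')" w] mem w cong_trans[OF cong_sym[OF d1] ww] by auto
      obtain c where c: "c \<in> {2..<int p}" "(z, z') = dilate w c"
        using offdiag_pair[of "(z, z')" w] mem w cong_trans[OF cong_sym[OF d2] ww] by auto
      \<comment> \<open>By \<open>pdiff_dilate\<close>, cancelling the unit \<open>w ^ p\<close> and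
        one factor \<open>p\<close> leaves the values of \<open>F\<close>.\<close>
      have key: "[poly F b = poly F a] (mod int p)"
        if "[pdiff (dilate w a) = pdiff (dilate w b)] (mod int p ^ 2)" for b
      proof -
        have "[w ^ p * (1 - int p * poly F a) = w ^ p * (1 - int p * poly F b)] (mod int p ^ 2)"
          using that pdiff_dilate by (metis cong_sym cong_trans)
        moreover have "coprime (w ^ p) (int p ^ 2)"
          using X_not_dvd[OF w] prime_int
          by (metis coprime_commute coprime_power_left_iff coprime_power_right_iff prime_imp_coprime)
        ultimately have "[1 - int p * poly F a = 1 - int p * poly F b] (mod int p ^ 2)"
          by (simp add: cong_mult_lcancel)
        then have "int p * int p dvd int p * (poly F b - poly F a)"
          by (simp add: cong_iff_dvd_diff power2_eq_square algebra_simps)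
        then show ?thesis using p_gt by (simp add: cong_iff_dvd_diff)
      qed
      have "(a, b, c) \<in> V"
      proof -
        let ?t = "poly F a mod int p"
        have "[poly F b = poly F a] (mod int p)" "[poly F c = poly F a] (mod int p)"
          using key e1 e2 unfolding a(2) b(2) c(2) by auto
        then have "a \<in> fib ?t" "b \<in> fib ?t" "c \<in> fib ?t"
          using a b c by (auto simp: fib_def Cong.cong_def)
        moreover have "?t \<in> {0..<int p}" using p_gt by simp
        ultimately show ?thesis unfolding V_def by blast
      qed
      then have "((x, x'), (y, y'), (z, z')) \<in> Off"
        unfolding a(2) b(2) c(2) Off_def using w by (intro image_eqI[of _ _ "(w, a, b, c)"]) auto
      then show ?thesis using noff by blast
    qed
  qed
  then have "energy3 \<le> card (Diag \<union> Off)"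
    unfolding energy3_def using finV by (intro card_mono) (auto simp: Diag_def Off_def)
  also have "\<dots> \<le> card Diag + card Off" by (rule card_Un_le)
  also have "card Diag \<le> card (X \<times> X \<times> X)" unfolding Diag_def by (intro card_image_le) simp
  also have "\<dots> \<le> p ^ 3"
    unfolding card_cartesian_product card_X power3_eq_cube mult.assoc by (intro mult_le_mono) auto
  also have "card Off \<le> card (X \<times> V)" unfolding Off_def using finV by (intro card_image_le) simp
  also have "\<dots> \<le> p * (\<Sum>t\<in>{0..<int p}. R t ^ 3)"
    unfolding card_cartesian_product card_X using cardV by (intro mult_le_mono) auto
  finally show ?thesis by simp
qed

lemma energy3_bound: "real energy3 \<le> 259585 * real p ^ 3 * (1 + ln (real p))"
proof -
  have "real energy3 \<le> real p ^ 3 + real p * real (\<Sum>t\<in>{0..<int p}. R t ^ 3)"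
    using of_nat_mono[OF energy3_le, where ?'a = real] by simp
  also have "\<dots> \<le> real p ^ 3 * (1 + ln (real p)) + real p * (259584 * real p ^ 2 * (1 + ln (real p)))"
  proof (intro add_mono mult_left_mono sum_R_cubed)
    have "ln (real p) \<ge> 0" using p_gt by simp
    then show "real p ^ 3 \<le> real p ^ 3 * (1 + ln (real p))" by (simp add: algebra_simps)
  qed simp
  also have "\<dots> = 259585 * real p ^ 3 * (1 + ln (real p))"
    by (simp add: power2_eq_square power3_eq_cube algebra_simps)
  finally show ?thesis .
qed

end

section \<open>Heilbronn sums\<close>

lemma sum_power_root_of_unity:
  fixes z :: complex
  assumes "z ^ m = 1" "z \<noteq> 1"
  shows "(\<Sum>k<m. z ^ k) = 0"
  using assms by (simp add: geometric_sum)

lemma norm_sum_squared_le: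
  fixes f :: "'a \<Rightarrow> complex"
  assumes "finite A"
  shows "(norm (sum f A))\<^sup>2 \<le> card A * (\<Sum>x\<in>A. (norm (f x))\<^sup>2)"
proof -
  have "(norm (sum f A))\<^sup>2 \<le> (\<Sum>x\<in>A. norm (f x))\<^sup>2"
    by (intro power_mono norm_sum) simp
  also have "\<dots> \<le> (\<Sum>x\<in>A. (norm (f x))\<^sup>2) * card A"
    by (rule sum_squared_le_sum_of_squares)
  finally show ?thesis by (simp add: mult.commute)
qed

lemma sum_product3:
  fixes a b c :: "'a \<Rightarrow> 'b :: semiring_0"
  shows "sum a A * sum b B * sum c C = (\<Sum>x\<in>A. \<Sum>y\<in>B. \<Sum>z\<in>C. a x * b y * c z)"
proof -
  have "sum a A * sum b B * sum c C = (\<Sum>x\<in>A. \<Sum>y\<in>B. a x * b y) * sum c C"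
    by (subst sum_product) (rule refl)
  also have "\<dots> = (\<Sum>x\<in>A. (\<Sum>y\<in>B. a x * b y) * sum c C)"
    by (rule sum_distrib_right)
  also have "\<dots> = (\<Sum>x\<in>A. \<Sum>y\<in>B. \<Sum>z\<in>C. a x * b y * c z)"
    by (intro sum.cong[OF refl]) (rule sum_product)
  finally show ?thesis .
qed

context odd_prime
begin

section \<open>Additive characters modulo \<open>p ^ 2\<close> and symmetries of the Heilbronn
  sum\<close>

definition U :: "int set" where "U = {0..<int p ^ 2}"

definition e :: "int \<Rightarrow> complex" where
  "e k = cis (2 * pi * of_int k / real (p ^ 2))"

definition heil :: "int \<Rightarrow> complex" where
  "heil k = (\<Sum>x\<in>X. e (k * x ^ p))"

lemma finite_U [simp]: "finite U"
  by (simp add: U_def)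

lemma e_0 [simp]: "e 0 = 1"
  by (simp add: e_def)

lemma e_add: "e (j + k) = e j * e k"
  by (simp add: e_def cis_mult add_divide_distrib distrib_left)

lemma cnj_e: "cnj (e k) = e (- k)"
  by (simp add: e_def cis_cnj)

lemma norm_e [simp]: "norm (e k) = 1"
  by (simp add: e_def)

lemma e_power: "e k ^ n = e (k * int n)"
  by (induction n) (auto simp: e_add[symmetric] algebra_simps)

lemma e_eq_1_iff: "e k = 1 \<longleftrightarrow> int p ^ 2 dvd k"
proof
  assume "e k = 1"
  then have "cos (2 * pi * of_int k / real (p ^ 2)) = 1"
    by (simp add: e_def complex_eq_iff)
  then obtain n where "2 * pi * of_int k / real (p ^ 2) = of_int n * 2 * pi"
    by (auto simp: cos_one_2pi_int)
  then have "real_of_int k = real_of_int (n * int p ^ 2)"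
    using p_gt by (simp add: field_simps)
  then have "k = n * int p ^ 2" by (simp only: of_int_eq_iff)
  then show "int p ^ 2 dvd k" by simp
next
  assume "int p ^ 2 dvd k"
  then obtain n where "k = int p ^ 2 * n" by (elim dvdE)
  then have "2 * pi * of_int k / real (p ^ 2) = 2 * pi * of_int n"
    using p_gt by (simp add: field_simps)
  then show "e k = 1" by (simp add: e_def cis_multiple_2pi)
qed

lemma e_cong: "[j = k] (mod int p ^ 2) \<Longrightarrow> e j = e k"
proof -
  assume "[j = k] (mod int p ^ 2)"
  then have "e (j - k) = 1" by (simp add: e_eq_1_iff cong_iff_dvd_diff)
  then show ?thesis using e_add[of "j - k" k] by simp
qed

lemma sum_e_U: "(\<Sum>k\<in>U. e (k * n)) = (if int p ^ 2 dvd n then of_nat (p ^ 2) else 0)"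
proof -
  have "U = int ` {..<p ^ 2}"
    unfolding U_def by (metis atLeast0LessThan image_int_atLeastLessThan of_nat_0 of_nat_power)
  then have "(\<Sum>k\<in>U. e (k * n)) = (\<Sum>k<p ^ 2. e n ^ k)"
    by (simp add: sum.reindex e_power mult.commute)
  also have "\<dots> = (if int p ^ 2 dvd n then of_nat (p ^ 2) else 0)"
  proof (cases "int p ^ 2 dvd n")
    case True
    then have "e n = 1" by (simp add: e_eq_1_iff)
    with True show ?thesis by simp
  next
    case False
    then have "(\<Sum>k<p ^ 2. e n ^ k) = 0"
      by (intro sum_power_root_of_unity) (auto simp: e_power e_eq_1_iff)
    with False show ?thesis by simp
  qed
  finally show ?thesis .
qed

lemma heil_cong: "[j = k] (mod int p ^ 2) \<Longrightarrow> heil j = heil k"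
  unfolding heil_def by (intro sum.cong refl e_cong cong_mult cong_refl)

text \<open>Multiplication by \<open>y\<close> permutes the nonzero residues modulo
  \<open>p\<close>, so the sum is invariant under the subgroup of p-th powers.\<close>

lemma heil_dilate:
  assumes "\<not> int p dvd y"
  shows "heil (k * y ^ p) = heil k"
proof -
  let ?f = "\<lambda>x. y * x mod int p"
  have into: "?f ` X \<subseteq> X"
    using assms X_not_dvd prime_int by (auto intro!: mod_in_X simp: prime_dvd_mult_iff)
  have inj: "inj_on ?f X"
  proof (rule inj_onI)
    fix x x' assume xx: "x \<in> X" "x' \<in> X" "?f x = ?f x'"
    then have "int p dvd y * (x - x')" by (simp add: mod_eq_dvd_iff algebra_simps)
    then have "[x = x'] (mod int p)"
      using dvd_prime_cancel[OF assms, of "x - x'"] by (simp only: cong_iff_dvd_diff)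
    then show "x = x'" using xx X_cong_imp_eq by simp
  qed
  have bij: "bij_betw ?f X X"
    using endo_inj_surj[OF finite_X into inj] inj by (simp add: bij_betw_def)
  have "heil k = (\<Sum>x\<in>X. e (k * (?f x) ^ p))"
    unfolding heil_def by (rule sum.reindex_bij_betw[OF bij, symmetric])
  also have "\<dots> = (\<Sum>x\<in>X. e (k * y ^ p * x ^ p))"
  proof (intro sum.cong refl e_cong)
    fix x
    have "[(?f x) ^ p = (y * x) ^ p] (mod int p ^ 2)"
      by (intro cong_power_prime_square) simp
    then have "[k * (?f x) ^ p = k * (y * x) ^ p] (mod int p ^ 2)" by (intro cong_mult cong_refl)
    then show "[k * (?f x) ^ p = k * y ^ p * x ^ p] (mod int p ^ 2)"
      by (simp add: power_mult_distrib mult.assoc)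
  qed
  finally show ?thesis by (simp add: heil_def)
qed

text \<open>As \<open>p\<close> is odd, -1 is itself a p-th power. Hence Heilbronn sums are
  real.\<close>

lemma heil_minus: "heil (- k) = heil k"
  using heil_dilate[of "-1" k] p_gt odd by (simp add: power_minus_odd)

lemma cnj_heil: "cnj (heil k) = heil k"
  by (subst (2) heil_minus[symmetric]) (simp add: heil_def cnj_e)

definition h :: "int \<Rightarrow> real" where "h k = Re (heil k)"

lemma heil_eq_h: "heil k = of_real (h k)"
  using cnj_heil[of k] by (simp add: h_def complex_eq_iff)

lemma h_squared: "complex_of_real ((h k)\<^sup>2) = (\<Sum>P\<in>X \<times> X. e (k * pdiff P))"
proof -
  have "complex_of_real ((h k)\<^sup>2) = heil k * cnj (heil k)"
    by (simp add: cnj_heil heil_eq_h power2_eq_square)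
  also have "\<dots> = (\<Sum>x\<in>X. \<Sum>y\<in>X. e (k * x ^ p) * e (- (k * y ^ p)))"
    by (simp add: heil_def cnj_e sum_product)
  also have "\<dots> = (\<Sum>P\<in>X \<times> X. e (k * pdiff P))"
    by (simp add: sum.cartesian_product pdiff_def e_add[symmetric] algebra_simps case_prod_beta)
  finally show ?thesis .
qed

text \<open>The matrix \<open>h (\<xi> (x^p - y^p))\<close> is positive semidefinite with eigenvector \<open>1\<close> and
  eigenvalue \<open>h \<xi> ^ 2\<close>; the trace of its cube dominates the cube of this eigenvalue.\<close>
lemma h_power6_le_trace:
  "(h \<xi>) ^ 6 \<le> (\<Sum>x\<in>X. \<Sum>y\<in>X. \<Sum>z\<in>X.
      h (\<xi> * (x ^ p - y ^ p)) * h (\<xi> * (x ^ p - z ^ p)) * h (\<xi> * (y ^ p - z ^ p)))"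
proof -
  \<comment> \<open>\<open>w l\<close> is the matrix applied to the character vector with index
    \<open>l\<close>. Summing its squared norms over \<open>l\<close> turns the characters into a
    third matrix entry, which gives the trace.\<close>
  define w where "w l x = (\<Sum>y\<in>X. heil (\<xi> * (x ^ p - y ^ p)) * e (\<xi> * l ^ p * y ^ p))" for l x :: int
  have split1: "e (\<xi> * (x ^ p - y ^ p) * m ^ p) = e (- \<xi> * y ^ p * m ^ p) * e (\<xi> * m ^ p * x ^ p)" for x y m
    by (simp add: e_add[symmetric] algebra_simps)
  have split2: "e (\<xi> * (y ^ p - z ^ p) * l ^ p) = e (\<xi> * l ^ p * y ^ p) * e (- (\<xi> * l ^ p * z ^ p))" for y z l
    by (simp add: e_add[symmetric] algebra_simps)
  have cnj_w: "cnj (w l x) = (\<Sum>z\<in>X. heil (\<xi> * (x ^ p - z ^ p)) * e (- (\<xi> * l ^ p * z ^ p)))" for l x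
    by (simp add: w_def cnj_heil cnj_e)
  have w_cnj: "w l x * cnj (w l x) = (\<Sum>y\<in>X. \<Sum>z\<in>X.
      heil (\<xi> * (x ^ p - y ^ p)) * heil (\<xi> * (x ^ p - z ^ p)) * e (\<xi> * (y ^ p - z ^ p) * l ^ p))" for l x
    unfolding cnj_w unfolding w_def sum_product split2 by (simp only: mult_ac)
  have pull: "(\<Sum>l\<in>X. a * b * e (k * l ^ p)) = a * b * heil k" for a b k
    by (simp only: heil_def sum_distrib_left)
  \<comment> \<open>The eigenvalue equation: all columns of the matrix have the sum
    \<open>(heil \<xi>)\<^sup>2\<close>.\<close>
  have inner: "(\<Sum>x\<in>X. heil (\<xi> * (x ^ p - y ^ p))) = (heil \<xi>)\<^sup>2" if "y \<in> X" for y
  proof -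
    have "(\<Sum>x\<in>X. heil (\<xi> * (x ^ p - y ^ p))) =
        (\<Sum>x\<in>X. \<Sum>m\<in>X. e (- \<xi> * y ^ p * m ^ p) * e (\<xi> * m ^ p * x ^ p))"
      by (simp only: heil_def split1)
    also have "\<dots> = (\<Sum>m\<in>X. e (- \<xi> * y ^ p * m ^ p) * heil (\<xi> * m ^ p))"
      by (subst sum.swap) (simp add: heil_def sum_distrib_left)
    also have "\<dots> = (\<Sum>m\<in>X. e (- \<xi> * y ^ p * m ^ p) * heil \<xi>)"
      by (intro sum.cong refl) (simp add: heil_dilate X_not_dvd)
    also have "\<dots> = heil (- \<xi> * y ^ p) * heil \<xi>"
      by (simp add: heil_def sum_distrib_right)
    also have "heil (- \<xi> * y ^ p) = heil \<xi>"
      by (simp only: heil_dilate[OF X_not_dvd[OF that]] heil_minus)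
    finally show ?thesis by (simp add: power2_eq_square)
  qed
  have sum_w: "(\<Sum>x\<in>X. w l x) = heil \<xi> ^ 3" if "l \<in> X" for l
  proof -
    have "(\<Sum>x\<in>X. w l x) = (\<Sum>y\<in>X. (\<Sum>x\<in>X. heil (\<xi> * (x ^ p - y ^ p))) * e (\<xi> * l ^ p * y ^ p))"
      unfolding w_def by (subst sum.swap) (simp add: sum_distrib_right)
    also have "\<dots> = (\<Sum>y\<in>X. (heil \<xi>)\<^sup>2 * e (\<xi> * l ^ p * y ^ p))"
      by (intro sum.cong refl) (simp add: inner)
    also have "\<dots> = (heil \<xi>)\<^sup>2 * heil (\<xi> * l ^ p)"
      by (simp add: heil_def sum_distrib_left)
    finally show ?thesis using that by (simp add: heil_dilate X_not_dvd power3_eq_cube power2_eq_square)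
  qed
  \<comment> \<open>Cauchy-Schwarz loses a factor \<open>p - 1\<close>, which the summation over
    \<open>l\<close> recovers.\<close>
  have cs: "(h \<xi>) ^ 6 \<le> real (p - 1) * (\<Sum>x\<in>X. (norm (w l x))\<^sup>2)" if "l \<in> X" for l
  proof -
    have "(norm (\<Sum>x\<in>X. w l x))\<^sup>2 = (h \<xi>) ^ 6"
      unfolding sum_w[OF that] heil_eq_h norm_power by simp
    then show ?thesis using norm_sum_squared_le[of X "w l"] by (simp add: card_X)
  qed
  have "(\<Sum>l\<in>X. (h \<xi>) ^ 6) \<le> (\<Sum>l\<in>X. real (p - 1) * (\<Sum>x\<in>X. (norm (w l x))\<^sup>2))"
    by (intro sum_mono cs)
  then have "real (p - 1) * (h \<xi>) ^ 6 \<le> real (p - 1) * (\<Sum>l\<in>X. \<Sum>x\<in>X. (norm (w l x))\<^sup>2)"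
    by (simp only: sum_constant card_X sum_distrib_left)
  then have le: "(h \<xi>) ^ 6 \<le> (\<Sum>l\<in>X. \<Sum>x\<in>X. (norm (w l x))\<^sup>2)"
    using p_gt by simp
  have "complex_of_real (\<Sum>l\<in>X. \<Sum>x\<in>X. (norm (w l x))\<^sup>2) = (\<Sum>l\<in>X. \<Sum>x\<in>X. w l x * cnj (w l x))"
    by (simp only: of_real_sum complex_norm_square)
  also have "\<dots> = (\<Sum>l\<in>X. \<Sum>x\<in>X. \<Sum>y\<in>X. \<Sum>z\<in>X.
      heil (\<xi> * (x ^ p - y ^ p)) * heil (\<xi> * (x ^ p - z ^ p)) * e (\<xi> * (y ^ p - z ^ p) * l ^ p))"
    by (simp only: w_cnj)
  also have "\<dots> = (\<Sum>x\<in>X. \<Sum>y\<in>X. \<Sum>z\<in>X. \<Sum>l\<in>X.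
      heil (\<xi> * (x ^ p - y ^ p)) * heil (\<xi> * (x ^ p - z ^ p)) * e (\<xi> * (y ^ p - z ^ p) * l ^ p))"
    by (rule trans[OF sum.swap], rule sum.cong[OF refl], rule trans[OF sum.swap],
        rule sum.cong[OF refl], rule sum.swap)
  also have "\<dots> = (\<Sum>x\<in>X. \<Sum>y\<in>X. \<Sum>z\<in>X.
      heil (\<xi> * (x ^ p - y ^ p)) * heil (\<xi> * (x ^ p - z ^ p)) * heil (\<xi> * (y ^ p - z ^ p)))"
    by (simp only: pull)
  also have "\<dots> = complex_of_real (\<Sum>x\<in>X. \<Sum>y\<in>X. \<Sum>z\<in>X.
      h (\<xi> * (x ^ p - y ^ p)) * h (\<xi> * (x ^ p - z ^ p)) * h (\<xi> * (y ^ p - z ^ p)))"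
    by (simp add: heil_eq_h)
  finally show ?thesis using le by (simp only: of_real_eq_iff)
qed

text \<open>Each squared sum is expanded over pairs. Orthogonality in \<open>u\<close> and
  \<open>v\<close> gives p^2 twice and forces pdiff P = pdiff S and pdiff Q = - pdiff S; swapping
  the pair \<open>Q\<close> makes this an energy count.\<close>

lemma sum_h6_le:
  assumes "coprime \<xi> (int p)"
  shows "(\<Sum>u\<in>U. \<Sum>v\<in>U. (h (\<xi> * u))\<^sup>2 * (h (\<xi> * v))\<^sup>2 * (h (\<xi> * (v - u)))\<^sup>2) \<le> real (p ^ 4 * energy3)"
proof -
  let ?Y = "X \<times> X"
  have cop: "int p ^ 2 dvd \<xi> * n \<longleftrightarrow> int p ^ 2 dvd n" for n
    using assms by (intro coprime_dvd_mult_right_iff) (simp add: coprime_commute)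
  have expand: "(\<Sum>u\<in>U. \<Sum>v\<in>U. e (\<xi> * u * pdiff P) * e (\<xi> * v * pdiff Q) * e (\<xi> * (v - u) * pdiff S)) =
      (if [pdiff P = pdiff S] (mod int p ^ 2) \<and> [pdiff Q = - pdiff S] (mod int p ^ 2) then of_nat (p ^ 4) else 0)"
    for P Q S
  proof -
    have "(\<Sum>u\<in>U. \<Sum>v\<in>U. e (\<xi> * u * pdiff P) * e (\<xi> * v * pdiff Q) * e (\<xi> * (v - u) * pdiff S)) =
       (\<Sum>u\<in>U. \<Sum>v\<in>U. e (u * (\<xi> * (pdiff P - pdiff S))) * e (v * (\<xi> * (pdiff Q + pdiff S))))"
      by (simp add: e_add[symmetric] algebra_simps)
    also have "\<dots> = (\<Sum>u\<in>U. e (u * (\<xi> * (pdiff P - pdiff S)))) * (\<Sum>v\<in>U. e (v * (\<xi> * (pdiff Q + pdiff S))))"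
      by (simp only: sum_product)
    also have "\<dots> = (if [pdiff P = pdiff S] (mod int p ^ 2) \<and> [pdiff Q = - pdiff S] (mod int p ^ 2) then of_nat (p ^ 4) else 0)"
      unfolding sum_e_U cop by (simp add: cong_iff_dvd_diff power_add[symmetric])
    finally show ?thesis .
  qed
  define G where "G = {(P, Q, S). P \<in> ?Y \<and> Q \<in> ?Y \<and> S \<in> ?Y \<and>
      [pdiff P = pdiff S] (mod int p ^ 2) \<and> [pdiff Q = - pdiff S] (mod int p ^ 2)}"
  have G_sub: "G \<subseteq> ?Y \<times> ?Y \<times> ?Y" by (auto simp: G_def)
  have "complex_of_real (\<Sum>u\<in>U. \<Sum>v\<in>U. (h (\<xi> * u))\<^sup>2 * (h (\<xi> * v))\<^sup>2 * (h (\<xi> * (v - u)))\<^sup>2) =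
     (\<Sum>u\<in>U. \<Sum>v\<in>U. (\<Sum>P\<in>?Y. e (\<xi> * u * pdiff P)) * (\<Sum>Q\<in>?Y. e (\<xi> * v * pdiff Q)) * (\<Sum>S\<in>?Y. e (\<xi> * (v - u) * pdiff S)))"
    unfolding of_real_sum of_real_mult h_squared ..
  also have "\<dots> = (\<Sum>u\<in>U. \<Sum>v\<in>U. \<Sum>P\<in>?Y. \<Sum>Q\<in>?Y. \<Sum>S\<in>?Y.
      e (\<xi> * u * pdiff P) * e (\<xi> * v * pdiff Q) * e (\<xi> * (v - u) * pdiff S))"
    by (simp only: sum_product3)
  also have "\<dots> = (\<Sum>W\<in>U \<times> U. \<Sum>V\<in>?Y \<times> ?Y \<times> ?Y.
      e (\<xi> * fst W * pdiff (fst V)) * e (\<xi> * snd W * pdiff (fst (snd V))) * e (\<xi> * (snd W - fst W) * pdiff (snd (snd V))))"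
    by (simp only: sum.cartesian_product' fst_conv snd_conv)
  also have "\<dots> = (\<Sum>V\<in>?Y \<times> ?Y \<times> ?Y. \<Sum>W\<in>U \<times> U.
      e (\<xi> * fst W * pdiff (fst V)) * e (\<xi> * snd W * pdiff (fst (snd V))) * e (\<xi> * (snd W - fst W) * pdiff (snd (snd V))))"
    by (rule sum.swap)
  also have "\<dots> = (\<Sum>V\<in>?Y \<times> ?Y \<times> ?Y. if V \<in> G then of_nat (p ^ 4) else 0)"
  proof (intro sum.cong refl)
    fix V assume V: "V \<in> ?Y \<times> ?Y \<times> ?Y"
    then obtain P Q S where PQS: "V = (P, Q, S)" "P \<in> ?Y" "Q \<in> ?Y" "S \<in> ?Y"
      by (cases V) blast
    have "V \<in> G \<longleftrightarrow> [pdiff P = pdiff S] (mod int p ^ 2) \<and> [pdiff Q = - pdiff S] (mod int p ^ 2)"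
      using PQS(2-4) unfolding PQS(1) G_def by simp
    then show "(\<Sum>W\<in>U \<times> U.
      e (\<xi> * fst W * pdiff (fst V)) * e (\<xi> * snd W * pdiff (fst (snd V))) * e (\<xi> * (snd W - fst W) * pdiff (snd (snd V))))
      = (if V \<in> G then of_nat (p ^ 4) else 0)"
      using expand[of P Q S] unfolding PQS(1) sum.cartesian_product' fst_conv snd_conv by (simp only:)
  qed
  also have "\<dots> = (\<Sum>V\<in>G. of_nat (p ^ 4))"
    using G_sub by (intro sum.mono_neutral_cong_right) auto
  also have "\<dots> = complex_of_real (real (p ^ 4 * card G))" by simp
  finally have eq: "(\<Sum>u\<in>U. \<Sum>v\<in>U. (h (\<xi> * u))\<^sup>2 * (h (\<xi> * v))\<^sup>2 * (h (\<xi> * (v - u)))\<^sup>2) = real (p ^ 4 * card G)"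
    by (simp only: of_real_eq_iff)
  have "card G \<le> energy3"
    unfolding energy3_def
  proof (rule card_inj_on_le)
    let ?f = "\<lambda>(P, Q, S). (P, prod.swap Q, S)"
    have swap: "pdiff (prod.swap Q) = - pdiff Q" for Q by (simp add: pdiff_def)
    show "inj_on ?f G" by (auto simp: inj_on_def)
    have "[pdiff P = - pdiff Q] (mod int p ^ 2)"
      if "[pdiff P = pdiff S] (mod int p ^ 2)" "[pdiff Q = - pdiff S] (mod int p ^ 2)" for P Q S
      using that dvd_add[of "int p ^ 2" "pdiff P - pdiff S" "pdiff Q + pdiff S"]
      by (simp add: cong_iff_dvd_diff)
    then show "?f ` G \<subseteq> {(P, Q, S). P \<in> ?Y \<and> Q \<in> ?Y \<and> S \<in> ?Y \<and>
        [pdiff P = pdiff Q] (mod int p ^ 2) \<and> [pdiff P = pdiff S] (mod int p ^ 2)}"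
      unfolding G_def by (auto simp: swap mem_Times_iff simp del: swap_simp)
    show "finite {(P, Q, S). P \<in> ?Y \<and> Q \<in> ?Y \<and> S \<in> ?Y \<and>
        [pdiff P = pdiff Q] (mod int p ^ 2) \<and> [pdiff P = pdiff S] (mod int p ^ 2)}"
      by (rule finite_subset[of _ "?Y \<times> ?Y \<times> ?Y"]) auto
  qed
  then have "p ^ 4 * card G \<le> p ^ 4 * energy3" by (rule mult_le_mono2)
  then show ?thesis unfolding eq by (rule of_nat_mono)
qed

text \<open>The triples in \<open>h_power6_le_trace\<close> are grouped by the differences (u, v) =
  (x^p - y^p, x^p - z^p), where y^p - z^p = v - u. Cauchy-Schwarz separates the multiplicities from
  the values, and the product of the two bounds is p^4 times the squared energy.\<close>

lemma h_power6_le: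
  assumes "coprime \<xi> (int p)"
  shows "(h \<xi>) ^ 6 \<le> real (p ^ 2 * energy3)"
proof -
  define I where "I = X \<times> X \<times> X"
  define \<phi> where "\<phi> = (\<lambda>(x, y, z). ((x ^ p - y ^ p) mod int p ^ 2, (x ^ p - z ^ p) mod int p ^ 2))"
  define g where "g = (\<lambda>(u, v). h (\<xi> * u) * h (\<xi> * v) * h (\<xi> * (v - u)))"
  define N where "N c = card {i \<in> I. \<phi> i = c}" for c
  have finI: "finite I" by (simp add: I_def)
  have h_mod: "h (\<xi> * n) = h (\<xi> * m)" if "[n = m] (mod int p ^ 2)" for n m
    unfolding h_def using that by (intro arg_cong[of _ _ Re] heil_cong cong_mult cong_refl)
  have into: "\<phi> ` I \<subseteq> U \<times> U"
    using p_gt by (auto simp: \<phi>_def U_def)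
  have g_phi: "g (\<phi> (x, y, z)) =
      h (\<xi> * (x ^ p - y ^ p)) * h (\<xi> * (x ^ p - z ^ p)) * h (\<xi> * (y ^ p - z ^ p))" for x y z
  proof -
    have 1: "h (\<xi> * ((x ^ p - y ^ p) mod int p ^ 2)) = h (\<xi> * (x ^ p - y ^ p))" for x y
      by (intro h_mod) simp
    have "[(x ^ p - z ^ p) mod int p ^ 2 - (x ^ p - y ^ p) mod int p ^ 2 = (x ^ p - z ^ p) - (x ^ p - y ^ p)] (mod int p ^ 2)"
      by (intro cong_diff) auto
    then have "h (\<xi> * ((x ^ p - z ^ p) mod int p ^ 2 - (x ^ p - y ^ p) mod int p ^ 2)) = h (\<xi> * (y ^ p - z ^ p))"
      by (intro h_mod) simp
    then show ?thesis by (simp add: g_def \<phi>_def 1)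
  qed
  have "(h \<xi>) ^ 6 \<le> (\<Sum>i\<in>I. g (\<phi> i))"
    using h_power6_le_trace[of \<xi>] unfolding I_def
    by (simp add: sum.cartesian_product g_phi[symmetric] case_prod_beta)
  also have "\<dots> = (\<Sum>c\<in>U \<times> U. \<Sum>i\<in>{i \<in> I. \<phi> i = c}. g (\<phi> i))"
    by (rule sum.group[symmetric]) (use finI into in auto)
  also have "\<dots> = (\<Sum>c\<in>U \<times> U. real (N c) * g c)"
    by (intro sum.cong refl) (simp add: N_def)
  finally have le: "(h \<xi>) ^ 6 \<le> (\<Sum>c\<in>U \<times> U. real (N c) * g c)" .
  have "((h \<xi>) ^ 6)\<^sup>2 \<le> (\<Sum>c\<in>U \<times> U. real (N c) * g c)\<^sup>2"
    using le by (intro power_mono) auto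
  also have "\<dots> \<le> (\<Sum>c\<in>U \<times> U. (real (N c))\<^sup>2) * (\<Sum>c\<in>U \<times> U. (g c)\<^sup>2)"
    by (rule Cauchy_Schwarz_ineq_sum)
  also have "\<dots> \<le> real energy3 * real (p ^ 4 * energy3)"
  proof (intro mult_mono sum_nonneg)
    have "(\<Sum>c\<in>U \<times> U. (g c)\<^sup>2) = (\<Sum>u\<in>U. \<Sum>v\<in>U. (h (\<xi> * u))\<^sup>2 * (h (\<xi> * v))\<^sup>2 * (h (\<xi> * (v - u)))\<^sup>2)"
      by (simp add: sum.cartesian_product g_def case_prod_beta power_mult_distrib)
    then show "(\<Sum>c\<in>U \<times> U. (g c)\<^sup>2) \<le> real (p ^ 4 * energy3)"
      using sum_h6_le[OF assms] by simp
    define E where "E = (\<Union>c\<in>U \<times> U. {i \<in> I. \<phi> i = c} \<times> {i \<in> I. \<phi> i = c})"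
    have "card E = (\<Sum>c\<in>U \<times> U. card ({i \<in> I. \<phi> i = c} \<times> {i \<in> I. \<phi> i = c}))"
      unfolding E_def using finI by (intro card_UN_disjoint) auto
    also have "\<dots> = (\<Sum>c\<in>U \<times> U. (N c)\<^sup>2)"
      by (simp add: card_cartesian_product N_def power2_eq_square)
    finally have cardE: "card E = (\<Sum>c\<in>U \<times> U. (N c)\<^sup>2)" .
    have "card E \<le> energy3" unfolding energy3_def
    proof (rule card_inj_on_le)
      \<comment> \<open>Equal differences within two triples become equal differences between them:
        a - b = a' - b' is the same as a - a' = b - b'.\<close>
      let ?f = "\<lambda>((x, y, z), (x', y', z')). ((x :: int, x' :: int), (y :: int, y' :: int), (z :: int, z' :: int))"
      show "inj_on ?f E" by (auto simp: inj_on_def)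
      show "?f ` E \<subseteq> {(P, Q, S). P \<in> X \<times> X \<and> Q \<in> X \<times> X \<and> S \<in> X \<times> X \<and>
        [pdiff P = pdiff Q] (mod int p ^ 2) \<and> [pdiff P = pdiff S] (mod int p ^ 2)}"
      proof (rule image_subsetI)
        fix W assume W: "W \<in> E"
        obtain x y z x' y' z' where xyz: "W = ((x, y, z), (x', y', z'))"
          by (metis prod.exhaust)
        have key: "[a - a' = b - b'] (mod int p ^ 2)"
          if "(a - b) mod int p ^ 2 = (a' - b') mod int p ^ 2" for a a' b b'
          using that unfolding mod_eq_dvd_iff cong_iff_dvd_diff by (simp add: algebra_simps)
        have "\<phi> (x, y, z) = \<phi> (x', y', z')" "(x, y, z) \<in> I" "(x', y', z') \<in> I"
          using W unfolding xyz E_def by auto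
        then show "?f W \<in> {(P, Q, S). P \<in> X \<times> X \<and> Q \<in> X \<times> X \<and> S \<in> X \<times> X \<and>
            [pdiff P = pdiff Q] (mod int p ^ 2) \<and> [pdiff P = pdiff S] (mod int p ^ 2)}"
          unfolding xyz I_def \<phi>_def pdiff_def by (auto intro: key)
      qed
      show "finite {(P, Q, S). P \<in> X \<times> X \<and> Q \<in> X \<times> X \<and> S \<in> X \<times> X \<and>
        [pdiff P = pdiff Q] (mod int p ^ 2) \<and> [pdiff P = pdiff S] (mod int p ^ 2)}"
        by (rule finite_subset[of _ "(X \<times> X) \<times> (X \<times> X) \<times> (X \<times> X)"]) auto
    qed
    then have "real (\<Sum>c\<in>U \<times> U. (N c)\<^sup>2) \<le> real energy3"
      unfolding cardE by (rule of_nat_mono)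
    then show "(\<Sum>c\<in>U \<times> U. (real (N c))\<^sup>2) \<le> real energy3" by simp
  qed auto
  also have "\<dots> = (real (p ^ 2 * energy3))\<^sup>2"
    by (simp add: power_mult_distrib power2_eq_square eval_nat_numeral)
  finally show ?thesis by (rule power2_le_imp_le) simp
qed

text \<open>For such \<open>k\<close>, k x^p = k x modulo p^2, so the sum is a full geometric sum,
  equal to 0, without its term 1.\<close>

lemma norm_heil_dvd:
  assumes "int p dvd k" "\<not> int p ^ 2 dvd k"
  shows "norm (heil k) = 1"
proof -
  obtain m where k: "k = int p * m" using assms(1) by (elim dvdE)
  have "heil k = (\<Sum>x\<in>X. e (k * x))"
    unfolding heil_def
  proof (intro sum.cong refl e_cong)
    fix x
    have "int p * int p dvd int p * (x ^ p - x)"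
      using fermat_int[of x] by (intro mult_dvd_mono) (auto simp: cong_iff_dvd_diff)
    then have "int p * int p dvd m * (int p * (x ^ p - x))" by (rule dvd_mult)
    then show "[k * x ^ p = k * x] (mod int p ^ 2)"
      unfolding cong_iff_dvd_diff k power2_eq_square by (simp add: algebra_simps)
  qed
  also have "\<dots> = (\<Sum>x\<in>{0..<int p}. e (k * x)) - 1"
  proof -
    have "{0..<int p} = insert 0 X" using p_gt by (auto simp: X_def)
    moreover have "0 \<notin> X" by (simp add: X_def)
    ultimately show ?thesis by simp
  qed
  also have "(\<Sum>x\<in>{0..<int p}. e (k * x)) = (\<Sum>x<p. e k ^ x)"
  proof -
    have "{0..<int p} = int ` {..<p}" by (metis atLeast0LessThan image_int_atLeastLessThan of_nat_0)
    then show ?thesis by (simp add: sum.reindex e_power)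
  qed
  also have "\<dots> = 0"
    using assms by (intro sum_power_root_of_unity)
      (auto simp: e_power e_eq_1_iff power2_eq_square k mult.commute mult.left_commute)
  finally show ?thesis by simp
qed

lemma norm_heil_le:
  assumes "1 \<le> B" "real (p ^ 2 * energy3) \<le> B ^ 6" "k \<in> U - {0}"
  shows "norm (heil k) \<le> B"
proof (cases "int p dvd k")
  case True
  have "\<not> int p ^ 2 dvd k" using assms(3) by (auto simp: U_def dest: zdvd_imp_le)
  then show ?thesis using norm_heil_dvd[OF True] assms(1) by simp
next
  case False
  then have "coprime k (int p)" by (metis coprime_commute prime_imp_coprime prime_int)
  then have "(h k) ^ 6 \<le> B ^ 6" using h_power6_le assms(2) by (meson order_trans)
  then have "\<bar>h k\<bar> ^ 6 \<le> B ^ 6" by (simp add: power_even_abs)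
  then have "\<bar>h k\<bar> \<le> B" using assms(1) power_mono_iff[of "\<bar>h k\<bar>" B 6] by simp
  then show ?thesis by (simp add: heil_eq_h)
qed

lemma norm_heil_trivial: "norm (heil k) \<le> real p"
proof -
  have "norm (heil k) \<le> (\<Sum>x\<in>X. norm (e (k * x ^ p)))" unfolding heil_def by (rule norm_sum)
  then show ?thesis by (simp add: card_X)
qed

end

section \<open>Elements of the subgroup in an interval\<close>

context odd_prime
begin

definition lifts :: "nat \<Rightarrow> int set" where
  "lifts M = {n \<in> {1..int M}. \<exists>x\<in>X. [n = x ^ p] (mod int p ^ 2)}"

lemma finite_lifts [simp]: "finite (lifts M)"
  unfolding lifts_def by (rule finite_subset[of _ "{1..int M}"]) auto

text \<open>A Dirichlet kernel; its squared absolute value is the Fejer kernel. The length is twice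
  \<open>M\<close> so that sums of two integers up to \<open>M\<close> still fit.\<close>

definition W :: "nat \<Rightarrow> int \<Rightarrow> complex" where
  "W M k = (\<Sum>j\<in>{1..2 * int M}. e (k * j))"

lemma W_norm_squared: "complex_of_real ((norm (W M k))\<^sup>2) =
    (\<Sum>j\<in>{1..2 * int M}. \<Sum>i\<in>{1..2 * int M}. e (k * (j - i)))"
proof -
  have split: "e (k * (j - i)) = e (k * j) * e (- (k * i))" for i j
    by (simp add: e_add[symmetric] algebra_simps)
  have "cnj (W M k) = (\<Sum>i\<in>{1..2 * int M}. e (- (k * i)))"
    by (simp add: W_def cnj_e)
  then show ?thesis
    by (simp only: complex_norm_square split sum_product W_def)
qed

text \<open>By orthogonality the sum is p^2 times the number of pairs congruent modulo p^2; each
  \<open>j\<close> has at most 2 M / p^2 + 1 partners, distinguished by their quotients by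
  p^2.\<close>

lemma sum_W_norm_squared: "(\<Sum>k\<in>U. (norm (W M k))\<^sup>2) \<le> 2 * real M * (2 * real M + real (p ^ 2))"
proof -
  let ?J = "{1..2 * int M}"
  have "complex_of_real (\<Sum>k\<in>U. (norm (W M k))\<^sup>2) = (\<Sum>k\<in>U. \<Sum>j\<in>?J. \<Sum>i\<in>?J. e (k * (j - i)))"
    by (simp only: of_real_sum W_norm_squared)
  also have "\<dots> = (\<Sum>j\<in>?J. \<Sum>i\<in>?J. \<Sum>k\<in>U. e (k * (j - i)))"
    by (rule trans[OF sum.swap], rule sum.cong[OF refl], rule sum.swap)
  also have "\<dots> = (\<Sum>j\<in>?J. \<Sum>i\<in>?J. of_real (if int p ^ 2 dvd j - i then real (p ^ 2) else 0))"
    unfolding sum_e_U by (intro sum.cong refl) simp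
  also have "\<dots> = complex_of_real (\<Sum>j\<in>?J. \<Sum>i\<in>?J. if int p ^ 2 dvd j - i then real (p ^ 2) else 0)"
    by (simp only: of_real_sum)
  finally have "(\<Sum>k\<in>U. (norm (W M k))\<^sup>2) = (\<Sum>j\<in>?J. \<Sum>i\<in>?J. if int p ^ 2 dvd j - i then real (p ^ 2) else 0)"
    by (simp only: of_real_eq_iff)
  also have "\<dots> \<le> (\<Sum>j\<in>?J. 2 * real M + real (p ^ 2))"
  proof (intro sum_mono)
    fix j :: int
    have "card {i \<in> ?J. int p ^ 2 dvd j - i} \<le> card {0..2 * int M div int p ^ 2}"
    proof (rule card_inj_on_le)
      show "inj_on (\<lambda>i. i div int p ^ 2) {i \<in> ?J. int p ^ 2 dvd j - i}"
      proof (rule inj_onI)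
        fix i i' assume a: "i \<in> {i \<in> ?J. int p ^ 2 dvd j - i}" "i' \<in> {i \<in> ?J. int p ^ 2 dvd j - i}"
          "i div int p ^ 2 = i' div int p ^ 2"
        then have "j mod int p ^ 2 = i mod int p ^ 2" "j mod int p ^ 2 = i' mod int p ^ 2"
          by (auto simp: mod_eq_dvd_iff)
        then show "i = i'" using a(3) by (metis mult_div_mod_eq)
      qed
      show "(\<lambda>i. i div int p ^ 2) ` {i \<in> ?J. int p ^ 2 dvd j - i} \<subseteq> {0..2 * int M div int p ^ 2}"
        using p_gt by (auto intro!: zdiv_mono1 simp: pos_imp_zdiv_nonneg_iff)
    qed simp
    moreover have "0 \<le> 2 * int M div int p ^ 2" using p_gt by (simp add: pos_imp_zdiv_nonneg_iff)
    ultimately have "int (card {i \<in> ?J. int p ^ 2 dvd j - i}) \<le> 2 * int M div int p ^ 2 + 1"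
      by (simp add: le_nat_iff)
    then have "real_of_int (int (card {i \<in> ?J. int p ^ 2 dvd j - i})) \<le> real_of_int (2 * int M div int p ^ 2 + 1)"
      by (simp only: of_int_le_iff)
    then have "real (card {i \<in> ?J. int p ^ 2 dvd j - i}) \<le> real_of_int (2 * int M div int p ^ 2) + 1"
      by (simp only: of_int_of_nat_eq of_int_add of_int_1)
    also have "\<dots> \<le> 2 * real M / real (p ^ 2) + 1"
      using real_of_int_div4[of "2 * int M" "int p ^ 2"] by simp
    finally have "real (card {i \<in> ?J. int p ^ 2 dvd j - i}) * real (p ^ 2) \<le> 2 * real M + real (p ^ 2)"
      using p_gt by (simp add: field_simps)
    then show "(\<Sum>i\<in>?J. if int p ^ 2 dvd j - i then real (p ^ 2) else 0) \<le> 2 * real M + real (p ^ 2)"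
      by (simp add: sum.If_cases Int_def)
  qed
  also have "\<dots> = 2 * real M * (2 * real M + real (p ^ 2))" by simp
  finally show ?thesis .
qed

text \<open>Detection by the Fejer kernel, whose Fourier coefficients \<open>norm (W M k) ^ 2\<close> are nonnegative
  and have a small sum, so that no logarithm is lost.\<close>
lemma card_lifts_le:
  assumes B: "\<And>k. k \<in> U - {0} \<Longrightarrow> norm (heil k) \<le> B" and "0 \<le> B" and M: "0 < M"
  shows "real (card (lifts M)) \<le> 4 * real M / real p + 2 * B * (2 * real M / real p ^ 2 + 1)"
proof -
  let ?J = "{1..2 * int M}"
  define Z where "Z = {(j, i, x). j \<in> ?J \<and> i \<in> ?J \<and> x \<in> X \<and> int p ^ 2 dvd j - i + x ^ p}"
  have Z_sub: "Z \<subseteq> ?J \<times> ?J \<times> X" by (auto simp: Z_def)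
  have finZ: "finite Z" using Z_sub by (rule finite_subset) simp
  have split: "e (k * (j - i + x ^ p)) = e (k * (j - i)) * e (k * x ^ p)" for i j k x
    by (simp add: e_add[symmetric] algebra_simps)
  have "(\<Sum>k\<in>U. complex_of_real ((norm (W M k))\<^sup>2) * heil k) =
      (\<Sum>k\<in>U. \<Sum>j\<in>?J. \<Sum>i\<in>?J. \<Sum>x\<in>X. e (k * (j - i + x ^ p)))"
    unfolding W_norm_squared heil_def split
    by (simp only: sum_distrib_right) (simp only: sum_distrib_left)
  also have "\<dots> = (\<Sum>j\<in>?J. \<Sum>i\<in>?J. \<Sum>x\<in>X. \<Sum>k\<in>U. e (k * (j - i + x ^ p)))"
    by (rule trans[OF sum.swap], rule sum.cong[OF refl], rule trans[OF sum.swap],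
        rule sum.cong[OF refl], rule sum.swap)
  also have "\<dots> = (\<Sum>V\<in>?J \<times> ?J \<times> X. if V \<in> Z then of_nat (p ^ 2) else 0)"
    unfolding sum_e_U sum.cartesian_product' by (intro sum.cong refl) (simp add: Z_def)
  also have "\<dots> = (\<Sum>V\<in>Z. of_nat (p ^ 2))"
    using Z_sub by (intro sum.mono_neutral_cong_right) auto
  also have "\<dots> = of_real (real (card Z * p ^ 2))" by simp
  finally have eq: "(\<Sum>k\<in>U. complex_of_real ((norm (W M k))\<^sup>2) * heil k) = of_real (real (card Z * p ^ 2))" .
  have "real (card Z * p ^ 2) = norm (\<Sum>k\<in>U. complex_of_real ((norm (W M k))\<^sup>2) * heil k)"
    unfolding eq by (simp only: norm_of_real abs_of_nat)
  also have "\<dots> \<le> (\<Sum>k\<in>U. (norm (W M k))\<^sup>2 * norm (heil k))"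
    by (rule order_trans[OF norm_sum]) (simp add: norm_mult norm_power)
  \<comment> \<open>The frequency 0 carries the main term; \<open>B\<close> bounds the Heilbronn sum
    at all others.\<close>
  also have "\<dots> = (norm (W M 0))\<^sup>2 * norm (heil 0) + (\<Sum>k\<in>U - {0}. (norm (W M k))\<^sup>2 * norm (heil k))"
    using p_gt by (intro sum.remove) (auto simp: U_def)
  also have "\<dots> \<le> (2 * real M)\<^sup>2 * real p + (\<Sum>k\<in>U. (norm (W M k))\<^sup>2 * B)"
  proof (intro add_mono mult_mono)
    show "(\<Sum>k\<in>U - {0}. (norm (W M k))\<^sup>2 * norm (heil k)) \<le> (\<Sum>k\<in>U. (norm (W M k))\<^sup>2 * B)"
    proof -
      have "(\<Sum>k\<in>U - {0}. (norm (W M k))\<^sup>2 * norm (heil k)) \<le> (\<Sum>k\<in>U - {0}. (norm (W M k))\<^sup>2 * B)"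
        using B by (intro sum_mono mult_left_mono) auto
      also have "\<dots> \<le> (\<Sum>k\<in>U. (norm (W M k))\<^sup>2 * B)"
        using assms(2) by (intro sum_mono2) auto
      finally show ?thesis .
    qed
  qed (auto simp: W_def norm_heil_trivial)
  also have "(\<Sum>k\<in>U. (norm (W M k))\<^sup>2 * B) \<le> (2 * real M * (2 * real M + real (p ^ 2))) * B"
    unfolding sum_distrib_right[symmetric] using assms(2) by (intro mult_right_mono sum_W_norm_squared)
  finally have upper: "real (card Z * p ^ 2) \<le>
      (2 * real M)\<^sup>2 * real p + 2 * real M * (2 * real M + real (p ^ 2)) * B" by simp
  have "\<forall>n\<in>lifts M. \<exists>x\<in>X. [n = x ^ p] (mod int p ^ 2)" by (auto simp: lifts_def)
  then obtain x where x: "\<And>n. n \<in> lifts M \<Longrightarrow> x n \<in> X \<and> [n = x n ^ p] (mod int p ^ 2)"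
    by metis
  \<comment> \<open>Each element \<open>n\<close> of the subgroup up to \<open>M\<close> is the
    difference of at least \<open>M\<close> pairs (i + n, i) in the range.\<close>
  have "card (lifts M \<times> {1..int M}) \<le> card Z"
  proof (rule card_inj_on_le[where f = "\<lambda>(n, i). (i, i + n, x n)"])
    show "inj_on (\<lambda>(n, i). (i, i + n, x n)) (lifts M \<times> {1..int M})"
      by (auto simp: inj_on_def)
    have dv: "int p ^ 2 dvd i - (i + n) + x n ^ p" if "n \<in> lifts M" for n i
      using x[OF that] by (simp add: cong_iff_dvd_diff dvd_diff_commute)
    show "(\<lambda>(n, i). (i, i + n, x n)) ` (lifts M \<times> {1..int M}) \<subseteq> Z"
    proof clarify
      fix n i assume n: "n \<in> lifts M" and i: "i \<in> {1..int M}"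
      have "1 \<le> n" "n \<le> int M" using n by (auto simp: lifts_def)
      then show "(i, i + n, x n) \<in> Z" unfolding Z_def using x[OF n] dv[OF n, of i] i by simp
    qed
  qed (rule finZ)
  then have "real (card (lifts M)) * real M \<le> real (card Z)"
    unfolding card_cartesian_product by (simp add: of_nat_mult[symmetric] del: of_nat_mult)
  then have "real (card (lifts M)) * real M * real (p ^ 2) \<le> real (card Z) * real (p ^ 2)"
    by (rule mult_right_mono) (rule of_nat_0_le_iff)
  also have "\<dots> = real (card Z * p ^ 2)" by (simp only: of_nat_mult)
  also note upper
  also have "(2 * real M)\<^sup>2 * real p + 2 * real M * (2 * real M + real (p ^ 2)) * B =
      (4 * real M / real p + 2 * B * (2 * real M / real p ^ 2 + 1)) * (real M * real (p ^ 2))"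
    using p_gt by (simp add: field_simps power2_eq_square)
  finally have "real (card (lifts M)) * (real M * real (p ^ 2)) \<le>
      (4 * real M / real p + 2 * B * (2 * real M / real p ^ 2 + 1)) * (real M * real (p ^ 2))"
    by (simp only: mult.assoc)
  moreover have "0 < real M * real (p ^ 2)" using M p_gt by simp
  ultimately show ?thesis by (rule mult_right_le_imp_le)
qed

text \<open>The hypothesis gives n = n^p modulo p^2, so \<open>n\<close> is the p-th power of its
  own residue modulo \<open>p\<close>.\<close>

lemma power_cong_1_imp_lift:
  assumes "[n ^ (p - 1) = 1] (mod int p ^ 2)"
  shows "\<exists>x\<in>X. [n = x ^ p] (mod int p ^ 2)"
proof (intro bexI)
  have "\<not> int p dvd n"
  proof
    assume "int p dvd n"
    then have "int p dvd n ^ (p - 1)" using dvd_trans[OF _ dvd_power[of "p - 1" n]] p_gt by simp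
    moreover have "int p dvd n ^ (p - 1) - 1"
      using cong_p_of_square[OF assms] by (simp add: cong_iff_dvd_diff)
    ultimately have "int p dvd 1" by (metis dvd_diff_right_iff)
    then show False using p_gt by simp
  qed
  then show "n mod int p \<in> X" by (rule mod_in_X)
  have "[n * 1 = n * n ^ (p - 1)] (mod int p ^ 2)"
    by (intro cong_mult cong_refl cong_sym[OF assms])
  also have "n * n ^ (p - 1) = n ^ p" using p_gt by (simp add: power_Suc[symmetric] del: power_Suc)
  also have "[n ^ p = (n mod int p) ^ p] (mod int p ^ 2)"
    by (intro cong_power_prime_square) simp
  finally show "[n = (n mod int p) ^ p] (mod int p ^ 2)" by simp
qed

text \<open>Zeros of the Fermat quotient prime to \<open>p\<close>, in the multiplicative form that
  is closed under products.\<close>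

definition unit_zeros :: "real \<Rightarrow> nat set" where
  "unit_zeros y = {n. 0 < n \<and> real n \<le> y \<and> [int n ^ (p - 1) = 1] (mod int p ^ 2)}"

lemma finite_unit_zeros [simp]: "finite (unit_zeros y)"
proof (rule finite_subset)
  show "unit_zeros y \<subseteq> {..nat \<lfloor>y\<rfloor>}" by (auto simp: unit_zeros_def le_nat_floor)
qed simp

text \<open>The three terms of \<open>card_lifts_le\<close> contribute 4, 4 and 2 multiples of y /
  p: the second by \<open>B \<le> real p\<close>, the third by
  \<open>real p * B \<le> y\<close>.\<close>

lemma card_unit_zeros_le:
  assumes "1 \<le> B" "B \<le> real p" "real (p ^ 2 * energy3) \<le> B ^ 6" "real p * B \<le> y"
  shows "real (card (unit_zeros y)) \<le> 10 * y / real p"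
proof -
  define M where "M = nat \<lfloor>y\<rfloor>"
  have "1 * 1 \<le> real p * B" using assms(1) p_gt by (intro mult_mono) auto
  then have y1: "1 \<le> y" using assms(4) by linarith
  then have M: "0 < M" "real M \<le> y" by (auto simp: M_def le_nat_floor)
  have "card (unit_zeros y) \<le> card (lifts M)"
  proof (rule card_inj_on_le[where f = int])
    show "int ` unit_zeros y \<subseteq> lifts M"
      using power_cong_1_imp_lift by (auto simp: unit_zeros_def lifts_def M_def le_floor_iff)
  qed auto
  then have "real (card (unit_zeros y)) \<le> real (card (lifts M))" by simp
  also have "\<dots> \<le> 4 * real M / real p + 2 * B * (2 * real M / real p ^ 2 + 1)"
    using assms(1) by (intro card_lifts_le norm_heil_le assms M) auto
  also have "\<dots> = 4 * real M / real p + 4 * (B / real p) * (real M / real p) + 2 * B"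
    using p_gt by (simp add: field_simps power2_eq_square)
  also have "\<dots> \<le> 4 * real M / real p + 4 * 1 * (real M / real p) + 2 * (y / real p)"
    using assms p_gt by (intro add_mono mult_mono order_refl) (auto simp: field_simps)
  also have "\<dots> = 8 * real M / real p + 2 * y / real p" by simp
  also have "\<dots> \<le> 8 * y / real p + 2 * y / real p"
    using M by (intro add_mono divide_right_mono) auto
  finally show ?thesis by simp
qed

text \<open>Multiples of \<open>p\<close> count as zeros by convention; up to
  \<open>N \<le> real p\<close> only \<open>p\<close> itself can occur.\<close>

lemma fermat_zeros_subset:
  assumes "N \<le> real p"
  shows "fermat_zeros p N \<subseteq> insert p (unit_zeros N)"
proof
  fix n assume n: "n \<in> fermat_zeros p N"
  then have n0: "0 < n" "real n \<le> N" "fermat_quotient p (int n) = 0" by (auto simp: fermat_zeros_def)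
  show "n \<in> insert p (unit_zeros N)"
  proof (cases "coprime (int n) (int p)")
    case False
    then have "int p dvd int n" by (metis coprime_commute prime_imp_coprime prime_int)
    then have "p \<le> n" using n0 by (simp add: dvd_imp_le)
    then show ?thesis using n0 assms by simp
  next
    case True
    let ?d = "(int n ^ (p - 1) - 1) div int p"
    have "[(THE q. [q = ?d] (mod int p) \<and> 0 \<le> q \<and> q \<le> int p - 1) = ?d] (mod int p)"
      using theI'[OF fermat_quotient_unique[of p "int n"]] p_gt by simp
    then have "[0 = ?d] (mod int p)" using n0(3) True by (simp add: fermat_quotient_def)
    then have "int p dvd ?d" by (metis cong_0_iff cong_sym)
    then have "int p * int p dvd int p * ?d" by simp
    also have "int p * ?d = int n ^ (p - 1) - 1"
      using fermat_quotient_exact[OF prime True] by simp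
    finally show ?thesis using n0 by (simp add: unit_zeros_def cong_iff_dvd_diff power2_eq_square)
  qed
qed

end

section \<open>Ordered factorizations\<close>

definition factorizations :: "nat \<Rightarrow> nat \<Rightarrow> nat list set" where
  "factorizations k m = {xs. length xs = k \<and> prod_list xs = m}"

lemma prod_list_dvd: "x \<in> set xs \<Longrightarrow> x dvd prod_list xs" for x :: nat
  by (induction xs) auto

lemma finite_factorizations: "0 < m \<Longrightarrow> finite (factorizations k m)"
proof (rule finite_subset)
  assume m: "0 < m"
  show "factorizations k m \<subseteq> {xs. set xs \<subseteq> {..m} \<and> length xs = k}"
    using m by (auto simp: factorizations_def intro!: dvd_imp_le prod_list_dvd)
qed (rule finite_lists_length_eq, simp)

lemma prod_list_update_mult:
  fixes xs :: "nat list"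
  assumes "i < length xs"
  shows "prod_list (xs[i := c * xs ! i]) = c * prod_list xs"
  using assms by (induction xs arbitrary: i) (auto split: nat.splits)

text \<open>The prime \<open>l\<close> divides one of the \<open>k\<close> entries; cancelling it
  there leaves a factorization of \<open>m\<close>.\<close>

lemma card_factorizations_prime_mult:
  assumes l: "prime l" and m: "0 < m"
  shows "card (factorizations k (l * m)) \<le> k * card (factorizations k m)"
proof -
  let ?f = "\<lambda>i xs. xs[i := l * xs ! i]"
  have "factorizations k (l * m) \<subseteq> (\<Union>i<k. ?f i ` factorizations k m)"
  proof
    fix xs assume xs: "xs \<in> factorizations k (l * m)"
    have "l dvd prod_list xs" using xs by (simp add: factorizations_def)
    then have "\<exists>i<length xs. l dvd xs ! i"
    proof (induction xs)
      case Nil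
      then show ?case using l by auto
    next
      case (Cons x xs)
      then have "l dvd x \<or> l dvd prod_list xs" using l by (simp add: prime_dvd_mult_iff)
      then show ?case using Cons.IH by fastforce
    qed
    then obtain i c where i: "i < length xs" "xs ! i = l * c" by (auto elim!: dvdE)
    define ys where "ys = xs[i := c]"
    have xs_eq: "xs = ys[i := l * ys ! i]"
      using i by (simp add: ys_def) (metis list_update_id)
    have "i < length ys" using i by (simp add: ys_def)
    then have "prod_list xs = l * prod_list ys"
      by (subst xs_eq) (rule prod_list_update_mult)
    then have "l * prod_list ys = l * m" using xs by (simp add: factorizations_def)
    then have "prod_list ys = m" using prime_gt_0_nat[OF l] by simp
    then have "ys \<in> factorizations k m" "i < k" using xs i by (auto simp: factorizations_def ys_def)
    then show "xs \<in> (\<Union>i<k. ?f i ` factorizations k m)" using xs_eq by blast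
  qed
  then have "card (factorizations k (l * m)) \<le> card (\<Union>i<k. ?f i ` factorizations k m)"
    using finite_factorizations[OF m] by (intro card_mono) auto
  also have "\<dots> \<le> (\<Sum>i<k. card (?f i ` factorizations k m))" by (intro card_UN_le) simp
  also have "\<dots> \<le> (\<Sum>i<k. card (factorizations k m))"
    using finite_factorizations[OF m] by (intro sum_mono card_image_le)
  finally show ?thesis by simp
qed

text \<open>A divisor is determined by its exponents at the primes up to \<open>y\<close>, and each
  exponent is at most \<open>L\<close> because \<open>m < 2 ^ Suc L\<close>.\<close>

lemma card_divisors_smooth:
  fixes m :: nat
  assumes m: "0 < m" "m < 2 ^ Suc L" and smooth: "\<And>l. prime l \<Longrightarrow> l dvd m \<Longrightarrow> l \<le> y"
  shows "card {d. d dvd m} \<le> Suc L ^ y"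
proof -
  let ?f = "\<lambda>d. \<lambda>l\<in>{1..y}. if prime l then multiplicity l d else 0"
  have "card {d. d dvd m} \<le> card ({1..y} \<rightarrow>\<^sub>E {..L})"
  proof (rule card_inj_on_le)
    show "inj_on ?f {d. d dvd m}"
    proof (rule inj_onI)
      fix d d' assume d: "d \<in> {d. d dvd m}" "d' \<in> {d. d dvd m}" "?f d = ?f d'"
      have pos: "0 < d" "0 < d'" using d m by (auto intro: dvd_pos_nat)
      show "d = d'"
      proof (rule multiplicity_eq_nat[OF pos])
        fix l :: nat assume l: "prime l"
        show "multiplicity l d = multiplicity l d'"
        proof (cases "l \<le> y")
          case True
          then have "l \<in> {1..y}" using prime_ge_1_nat[OF l] by simp
          then show ?thesis using fun_cong[OF d(3), of l] l by simp
        next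
          case False
          then have "\<not> l dvd d" "\<not> l dvd d'" using smooth[OF l] d by (auto intro: dvd_trans)
          then show ?thesis by (simp add: not_dvd_imp_multiplicity_0)
        qed
      qed
    qed
    show "?f ` {d. d dvd m} \<subseteq> {1..y} \<rightarrow>\<^sub>E {..L}"
    proof (clarsimp)
      fix d l :: nat assume d: "d dvd m" and l: "prime l"
      have "l ^ multiplicity l d dvd m" using multiplicity_dvd[of l d] d by (rule dvd_trans)
      then have "l ^ multiplicity l d \<le> m" using m by (intro dvd_imp_le)
      moreover have "2 ^ multiplicity l d \<le> l ^ multiplicity l d"
        using prime_ge_2_nat[OF l] by (intro power_mono) auto
      ultimately have "(2 :: nat) ^ multiplicity l d < 2 ^ Suc L" using m(2) by linarith
      then show "multiplicity l d \<le> L" by (simp only: power_strict_increasing_iff less_Suc_eq_le)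
    qed
  qed (intro finite_PiE, simp_all)
  also have "\<dots> = Suc L ^ y" by (simp add: card_PiE)
  finally show ?thesis .
qed

lemma card_factorizations_le_divisors:
  assumes "0 < m"
  shows "card (factorizations k m) \<le> card {d. d dvd m} ^ k"
proof -
  have fin: "finite {d. d dvd m}" using assms by simp
  have "factorizations k m \<subseteq> {xs. set xs \<subseteq> {d. d dvd m} \<and> length xs = k}"
    by (auto simp: factorizations_def intro: prod_list_dvd)
  then have "card (factorizations k m) \<le> card {xs. set xs \<subseteq> {d. d dvd m} \<and> length xs = k}"
    using fin by (intro card_mono finite_lists_length_eq)
  then show ?thesis by (simp add: card_lists_length_eq[OF fin])
qed

text \<open>Primes above \<open>y\<close> are split off one at a time, at the cost of a factor \<open>k \<le> y powr \<sigma>\<close> each;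
  the remaining smooth part has few divisors.\<close>
lemma card_factorizations_le:
  fixes m :: nat and \<sigma> :: real
  assumes "0 \<le> \<sigma>" and "real k \<le> real y powr \<sigma>" and "0 < m" and "m < 2 ^ Suc L"
  shows "real (card (factorizations k m)) \<le> real m powr \<sigma> * (real (Suc L) ^ y) ^ k"
  using assms(3-)
proof (induction m rule: less_induct)
  case (less m)
  show ?case
  proof (cases "\<exists>l. prime l \<and> l dvd m \<and> y < l")
    case False
    then have "card (factorizations k m) \<le> (Suc L ^ y) ^ k"
      using less.prems by (intro order_trans[OF card_factorizations_le_divisors] power_mono
          card_divisors_smooth) (auto simp: not_less)
    then have "real (card (factorizations k m)) \<le> 1 * (real (Suc L) ^ y) ^ k"
      by (metis mult_1 of_nat_le_iff of_nat_power)
    also have "\<dots> \<le> real m powr \<sigma> * (real (Suc L) ^ y) ^ k"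
      using less.prems assms(1) by (intro mult_right_mono ge_one_powr_ge_zero) auto
    finally show ?thesis .
  next
    case True
    then obtain l n where l: "prime l" "y < l" "m = l * n" by (auto elim!: dvdE)
    have n: "0 < n" "n < m" using less.prems l prime_gt_1_nat[OF l(1)] by auto
    have "real (card (factorizations k m)) \<le> real k * real (card (factorizations k n))"
      using card_factorizations_prime_mult[OF l(1) n(1), of k] unfolding l(3)
      by (metis of_nat_le_iff of_nat_mult)
    also have "\<dots> \<le> real l powr \<sigma> * (real n powr \<sigma> * (real (Suc L) ^ y) ^ k)"
    proof (intro mult_mono less.IH n)
      have "real y powr \<sigma> \<le> real l powr \<sigma>" using l assms(1) by (intro powr_mono2) auto
      then show "real k \<le> real l powr \<sigma>" using assms(2) by linarith
      show "n < 2 ^ Suc L" using n less.prems by linarith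
    qed auto
    also have "\<dots> = real m powr \<sigma> * (real (Suc L) ^ y) ^ k"
      by (simp add: l(3) powr_mult)
    finally show ?thesis .
  qed
qed

text \<open>Taking products maps the \<open>k\<close>-tuples over \<open>Q\<close> into
  \<open>G\<close>, and the fibres consist of ordered factorizations.\<close>

lemma card_power_le_factorizations:
  fixes Q G :: "nat set"
  assumes "finite Q" "finite G" "\<And>xs. set xs \<subseteq> Q \<Longrightarrow> length xs = k \<Longrightarrow> prod_list xs \<in> G"
    and "\<And>m. m \<in> G \<Longrightarrow> 0 < m" and "\<And>m. m \<in> G \<Longrightarrow> real (card (factorizations k m)) \<le> C"
  shows "real (card Q) ^ k \<le> real (card G) * C"
proof -
  have "{xs. set xs \<subseteq> Q \<and> length xs = k} \<subseteq> (\<Union>m\<in>G. factorizations k m)"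
    using assms(3) by (auto simp: factorizations_def)
  then have "card {xs. set xs \<subseteq> Q \<and> length xs = k} \<le> card (\<Union>m\<in>G. factorizations k m)"
    using assms(2,4) by (intro card_mono finite_UN_I finite_factorizations) auto
  also have "\<dots> \<le> (\<Sum>m\<in>G. card (factorizations k m))" by (intro card_UN_le assms(2))
  finally have "card Q ^ k \<le> (\<Sum>m\<in>G. card (factorizations k m))"
    by (simp add: card_lists_length_eq[OF assms(1)])
  then have "real (card Q) ^ k \<le> (\<Sum>m\<in>G. real (card (factorizations k m)))"
    by (metis of_nat_le_iff of_nat_power of_nat_sum)
  also have "\<dots> \<le> (\<Sum>m\<in>G. C)" using assms(5) by (intro sum_mono)
  finally show ?thesis by simp
qed

context odd_prime
begin

lemma prod_list_unit_zeros:
  assumes "1 \<le> N" "set xs \<subseteq> unit_zeros N"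
  shows "prod_list xs \<in> unit_zeros (N ^ length xs)"
  using assms(2)
proof (induction xs)
  case Nil
  then show ?case by (simp add: unit_zeros_def)
next
  case (Cons x xs)
  then have x: "0 < x" "real x \<le> N" "[int x ^ (p - 1) = 1] (mod int p ^ 2)"
    and y: "0 < prod_list xs" "real (prod_list xs) \<le> N ^ length xs"
      "[int (prod_list xs) ^ (p - 1) = 1] (mod int p ^ 2)"
    by (auto simp: unit_zeros_def)
  have "real x * real (prod_list xs) \<le> N * N ^ length xs"
    using x y assms(1) by (intro mult_mono) auto
  moreover have "[int x ^ (p - 1) * int (prod_list xs) ^ (p - 1) = 1 * 1] (mod int p ^ 2)"
    by (intro cong_mult x y)
  ultimately show ?case using x y by (simp add: unit_zeros_def power_mult_distrib)
qed

lemma card_unit_zeros_power_le: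
  assumes N: "1 \<le> N" and B: "1 \<le> B" "B \<le> real p" "real (p ^ 2 * energy3) \<le> B ^ 6"
    and large: "real p * B \<le> N ^ k" and \<sigma>: "0 \<le> \<sigma>"
    and y: "real k \<le> real y powr \<sigma>" and L: "N ^ k < 2 ^ Suc L"
  shows "real (card (unit_zeros N)) ^ k \<le>
      10 * N ^ k / real p * ((N ^ k) powr \<sigma> * (real (Suc L) ^ y) ^ k)"
proof -
  have "real (card (unit_zeros N)) ^ k \<le>
      real (card (unit_zeros (N ^ k))) * ((N ^ k) powr \<sigma> * (real (Suc L) ^ y) ^ k)"
  proof (rule card_power_le_factorizations)
    fix m assume "m \<in> unit_zeros (N ^ k)"
    then have m: "0 < m" "real m \<le> N ^ k" by (auto simp: unit_zeros_def)
    have "real m < real (2 ^ Suc L)" using m L by simp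
    then have "m < 2 ^ Suc L" by (simp only: of_nat_less_iff)
    then have "real (card (factorizations k m)) \<le> real m powr \<sigma> * (real (Suc L) ^ y) ^ k"
      using m \<sigma> y by (intro card_factorizations_le) auto
    also have "\<dots> \<le> (N ^ k) powr \<sigma> * (real (Suc L) ^ y) ^ k"
      using m \<sigma> by (intro mult_right_mono powr_mono2) auto
    finally show "real (card (factorizations k m)) \<le> (N ^ k) powr \<sigma> * (real (Suc L) ^ y) ^ k" .
  next
    fix xs assume "set xs \<subseteq> unit_zeros N" "length xs = k"
    then show "prod_list xs \<in> unit_zeros (N ^ k)" using prod_list_unit_zeros[OF N] by blast
  qed (rule finite_unit_zeros, rule finite_unit_zeros, simp add: unit_zeros_def)
  also have "\<dots> \<le> 10 * N ^ k / real p * ((N ^ k) powr \<sigma> * (real (Suc L) ^ y) ^ k)"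
    by (intro mult_right_mono card_unit_zeros_le[OF B large]) auto
  finally show ?thesis .
qed

end

section \<open>Asymptotics\<close>

lemma eventually_prime_primes_at_top: "\<forall>\<^sub>F p in primes_at_top. prime p"
  by (simp add: eventually_primes_at_top)

lemma filterlim_ln_primes_at_top: "filterlim (\<lambda>p. ln (real p)) at_top primes_at_top"
proof -
  have "filterlim (\<lambda>p. ln (real p)) at_top at_top"
    by (rule filterlim_compose[OF ln_at_top filterlim_real_sequentially])
  then show ?thesis by (rule filterlim_mono) (auto simp: primes_at_top_def)
qed

text \<open>Combines the bounds for all fixed \<open>\<delta>\<close> into a single bound with an
  o(1) in the exponent.\<close>

lemma exponent_of_eventual_bounds:
  fixes a b T :: "nat \<Rightarrow> real"
  assumes pos: "\<forall>\<^sub>F p in Fl. 0 \<le> a p \<and> 0 < b p \<and> 0 < T p \<and> 1 < real p"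
    and bound: "\<And>\<delta>. 0 < \<delta> \<Longrightarrow> \<forall>\<^sub>F p in Fl. a p \<le> b p * real p powr (- (1 - \<delta>) / T p)"
  shows "\<exists>d. (d \<longlongrightarrow> 0) Fl \<and> (\<forall>\<^sub>F p in Fl. a p \<le> b p * real p powr (- (1 + d p) / T p))"
proof -
  define x where "x p = - 1 - T p * ln (a p / b p) / ln (real p)" for p
  \<comment> \<open>\<open>x p\<close> is the exponent that gives equality. Only lower bounds for it
    are known, so positive values are cut off; where \<open>a p = 0\<close> any exponent will
    do.\<close>
  define d where "d p = (if a p = 0 then 0 else min 0 (x p))" for p
  have "(d \<longlongrightarrow> 0) Fl"
  proof (rule tendstoI)
    fix \<delta> :: real assume \<delta>: "0 < \<delta>"
    have "\<forall>\<^sub>F p in Fl. a p \<le> b p * real p powr (- (1 - \<delta> / 2) / T p)"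
      using \<delta> by (intro bound) simp
    then show "\<forall>\<^sub>F p in Fl. dist (d p) 0 < \<delta>"
      using pos
    proof eventually_elim
      case (elim p)
      show ?case
      proof (cases "a p = 0")
        case False
        then have a: "0 < a p" using elim by simp
        have lnp: "0 < ln (real p)" using elim by simp
        have "a p / b p \<le> real p powr (- (1 - \<delta> / 2) / T p)"
          using elim by (simp add: field_simps)
        then have "ln (a p / b p) \<le> ln (real p powr (- (1 - \<delta> / 2) / T p))"
          using a elim by (intro ln_mono) auto
        also have "\<dots> = (- (1 - \<delta> / 2) / T p) * ln (real p)" using elim by (simp add: ln_powr)
        finally have "T p * ln (a p / b p) \<le> T p * ((- (1 - \<delta> / 2) / T p) * ln (real p))"
          using elim by (intro mult_left_mono) auto
        also have "\<dots> = - (1 - \<delta> / 2) * ln (real p)" using elim by simp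
        finally have "T p * ln (a p / b p) / ln (real p) \<le> - (1 - \<delta> / 2)"
          using lnp by (simp add: field_simps)
        then have "- (\<delta> / 2) \<le> x p" by (simp add: x_def)
        then show ?thesis using \<delta> False by (simp add: d_def dist_real_def min_def)
      qed (use \<delta> in \<open>simp add: d_def\<close>)
    qed
  qed
  moreover have "\<forall>\<^sub>F p in Fl. a p \<le> b p * real p powr (- (1 + d p) / T p)"
    using pos
  proof eventually_elim
    case (elim p)
    show ?case
    proof (cases "a p = 0")
      case False
      then have a: "0 < a p" using elim by simp
      have lnp: "0 < ln (real p)" using elim by simp
      have "a p / b p = exp (ln (a p / b p))" using a elim by simp
      also have "ln (a p / b p) = (- (1 + x p) / T p) * ln (real p)"
        using lnp elim by (simp add: x_def field_simps)
      also have "exp \<dots> = real p powr (- (1 + x p) / T p)"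
        using elim by (simp add: powr_def)
      also have "\<dots> \<le> real p powr (- (1 + d p) / T p)"
        using False elim by (intro powr_mono divide_right_mono) (auto simp: d_def)
      finally show ?thesis using elim by (simp add: field_simps)
    qed (use elim in simp)
  qed
  ultimately show ?thesis by blast
qed

lemma card_fermat_zeros_eventually_le:
  fixes \<alpha> \<delta> :: real and N u e :: "nat \<Rightarrow> real"
  assumes \<alpha>: "\<alpha> > 463 / 252" and \<delta>: "0 < \<delta>"
    and N: "\<And>p. prime p \<Longrightarrow> N p \<ge> 2 \<and> u p = ln (real p) / ln (N p)"
    and u1: "\<forall>\<^sub>F p in primes_at_top. 1 \<le> u p"
    and e0: "(e \<longlongrightarrow> 0) primes_at_top"
    and ue: "\<forall>\<^sub>F p in primes_at_top. u p = ln (real p) powr e p"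
  shows "\<forall>\<^sub>F p in primes_at_top. real (card (fermat_zeros p (N p)))
      \<le> 11 * (u p * N p) * real p powr (- (1 - \<delta>) / of_int \<lceil>\<alpha> * u p\<rceil>)"
proof -
  \<comment> \<open>The factorization count costs (N^k)^\<sigma>, at most p^((\<alpha> + 1)
    \<sigma>), for the large primes and p^\<sigma> for the smooth part; together this is
    p^\<delta>.\<close>
  define \<sigma> where "\<sigma> = \<delta> / (\<alpha> + 2)"
  have \<sigma>: "0 < \<sigma>" using \<alpha> \<delta> by (simp add: \<sigma>_def)
  \<comment> \<open>Chosen so that \<open>u p \<le> ln (real p) powr \<eta>\<close> bounds
    \<open>y * k\<close>, of order k^(1 + 1/\<sigma>), by a multiple of the square root of the
    logarithm.\<close>
  define \<eta> where "\<eta> = 1 / (2 * (1 + 1 / \<sigma>))"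
  have "0 < 1 + 1 / \<sigma>" using \<sigma> by (simp add: add_pos_pos)
  then have \<eta>: "0 < \<eta>" "\<eta> * (1 + 1 / \<sigma>) = 1 / 2" by (simp_all add: \<eta>_def)
  define K where "K = 2 * (\<alpha> + 1) powr (1 + 1 / \<sigma>)"
  define C where "C = (\<alpha> + 1) / ln 2 + 1"
  have K: "0 < K" and C: "0 < C" using \<alpha> by (auto simp: K_def C_def add_pos_pos)
  have "\<forall>\<^sub>F x in at_top. K * x powr (1 / 2) * ln (C * x) \<le> \<sigma> * x"
    using K C \<sigma> by real_asymp
  then have ev1: "\<forall>\<^sub>F p in primes_at_top. K * ln (real p) powr (1 / 2) * ln (C * ln (real p)) \<le> \<sigma> * ln (real p)"
    using filterlim_ln_primes_at_top by (rule eventually_compose_filterlim)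
  \<comment> \<open>The exponent is 6 * 211 / 252, slightly above 5, which absorbs the logarithm in
    the energy bound.\<close>
  have "\<forall>\<^sub>F p in sequentially. 259585 * real p ^ 5 * (1 + ln (real p)) \<le> real p powr (1266 / 252)"
    by real_asymp
  then have ev2: "\<forall>\<^sub>F p in primes_at_top. 259585 * real p ^ 5 * (1 + ln (real p)) \<le> real p powr (1266 / 252)"
    unfolding primes_at_top_def by (rule filter_leD[OF inf_le1])
  have ev3: "\<forall>\<^sub>F p in primes_at_top. e p < \<eta>"
    using e0 \<eta>(1) by (rule order_tendstoD)
  have ev4: "\<forall>\<^sub>F p in primes_at_top. 2 \<le> ln (real p)"
    using filterlim_ln_primes_at_top by (simp add: filterlim_at_top)
  show ?thesis
    using ev1 ev2 ev3 ev4 u1 ue eventually_prime_primes_at_top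
  proof eventually_elim
    case (elim p)
    have p2: "2 < p"
    proof (rule ccontr)
      assume "\<not> 2 < p"
      then have "p = 2" using prime_ge_2_nat[of p] elim by simp
      moreover have "ln (2 :: real) < 1" using ln_less_self[of "2 :: real"] ln_2_less_1 by simp
      ultimately show False using elim by simp
    qed
    interpret odd_prime p
      using elim p2 prime_odd_nat by unfold_locales auto
    define n where "n = N p"
    have n2: "2 \<le> n" and un: "u p = ln (real p) / ln n" using N elim by (auto simp: n_def)
    have lnn: "0 < ln n" using n2 by simp
    have lnp: "0 < ln (real p)" using p2 by simp
    have n_le: "n \<le> real p"
    proof -
      have "ln n \<le> ln (real p)" using elim(5) lnn unfolding un by (simp add: field_simps)
      then show ?thesis using n2 p2 by simp
    qed
    define k where "k = nat \<lceil>\<alpha> * u p\<rceil>"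
    have au: "1 < \<alpha> * u p"
    proof -
      have "1 * 1 < \<alpha> * u p" using \<alpha> elim(5) by (intro mult_less_le_imp_less) auto
      then show ?thesis by simp
    qed
    then have kpos: "0 < k" by (simp add: k_def)
    have k_int: "real_of_int \<lceil>\<alpha> * u p\<rceil> = real k" using au by (simp add: k_def)
    have k_ge: "\<alpha> * u p \<le> real k" and k_le: "real k \<le> \<alpha> * u p + 1"
      unfolding k_int[symmetric] by linarith+
    have nk: "n ^ k = exp (real k * ln n)" using n2 by (simp add: exp_of_nat_mult)
    have nk_ge: "real p powr \<alpha> \<le> n ^ k"
    proof -
      have "\<alpha> * ln (real p) = \<alpha> * u p * ln n" using lnn by (simp add: un)
      also have "\<dots> \<le> real k * ln n" using k_ge lnn by (intro mult_right_mono) auto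
      finally show ?thesis unfolding nk using p2 by (simp add: powr_def)
    qed
    have nk_le: "n ^ k \<le> real p powr (\<alpha> + 1)"
    proof -
      have "real k * ln n \<le> (\<alpha> * u p + 1) * ln n" using k_le lnn by (intro mult_right_mono) auto
      also have "\<dots> = \<alpha> * ln (real p) + ln n" using lnn by (simp add: un field_simps)
      also have "\<dots> \<le> \<alpha> * ln (real p) + ln (real p)" using n2 n_le by simp
      finally show ?thesis unfolding nk using p2 by (simp add: powr_def algebra_simps)
    qed
    define B where "B = real p powr (211 / 252)"
    have B: "1 \<le> B" "B \<le> real p"
      using p2 powr_mono[of "211 / 252" 1 "real p"] by (auto simp: B_def ge_one_powr_ge_zero)
    have B6: "real (p ^ 2 * energy3) \<le> B ^ 6"
    proof -
      have "real (p ^ 2 * energy3) \<le> real p ^ 2 * (259585 * real p ^ 3 * (1 + ln (real p)))"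
        using energy3_bound by (simp add: mult_left_mono)
      also have "\<dots> = 259585 * real p ^ 5 * (1 + ln (real p))" by (simp add: eval_nat_numeral)
      also have "\<dots> \<le> real p powr (1266 / 252)" by (rule elim)
      also have "\<dots> = B ^ 6" using p2 by (simp add: B_def powr_power)
      finally show ?thesis .
    qed
    have large: "real p * B \<le> n ^ k"
    proof -
      have "real p * B = real p powr (463 / 252)" using p2 by (simp add: B_def powr_mult_base)
      also have "\<dots> \<le> real p powr \<alpha>" using \<alpha> p2 by (intro powr_mono) auto
      finally show ?thesis using nk_ge by simp
    qed
    \<comment> \<open>The least integer threshold with
      \<open>real k \<le> real y powr \<sigma>\<close>.\<close>
    define y where "y = nat \<lceil>real k powr (1 / \<sigma>)\<rceil>"
    have y_ge: "real k powr (1 / \<sigma>) \<le> real y" unfolding y_def by linarith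
    have ky: "real k \<le> real y powr \<sigma>"
    proof -
      have "real k = (real k powr (1 / \<sigma>)) powr \<sigma>" using \<sigma> kpos by (simp add: powr_powr)
      also have "\<dots> \<le> real y powr \<sigma>" using y_ge \<sigma> by (intro powr_mono2) auto
      finally show ?thesis .
    qed
    have k1: "1 \<le> real k powr (1 / \<sigma>)" using kpos \<sigma> by (intro ge_one_powr_ge_zero) auto
    have "real (y * k) \<le> 2 * real k powr (1 / \<sigma>) * real k"
    proof -
      have "real y \<le> real k powr (1 / \<sigma>) + 1" unfolding y_def using k1 by linarith
      then have "real y \<le> 2 * real k powr (1 / \<sigma>)" using k1 by linarith
      then show ?thesis by (simp add: mult_right_mono)
    qed
    also have "\<dots> = 2 * real k powr (1 + 1 / \<sigma>)" using kpos by (simp add: powr_add)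
    also have "\<dots> \<le> 2 * ((\<alpha> + 1) * u p) powr (1 + 1 / \<sigma>)"
    proof -
      have "real k \<le> (\<alpha> + 1) * u p" using k_le elim(5) by (simp add: algebra_simps)
      then show ?thesis using \<sigma> by (intro mult_left_mono powr_mono2) auto
    qed
    also have "\<dots> = K * u p powr (1 + 1 / \<sigma>)"
      using \<alpha> elim(5) by (simp add: K_def powr_mult)
    also have "\<dots> \<le> K * (ln (real p) powr \<eta>) powr (1 + 1 / \<sigma>)"
    proof -
      have "u p \<le> ln (real p) powr \<eta>" unfolding elim(6) using elim by (intro powr_mono) auto
      then show ?thesis using K \<sigma> elim(5) by (intro mult_left_mono powr_mono2) auto
    qed
    also have "\<dots> = K * ln (real p) powr (1 / 2)" by (simp only: powr_powr \<eta>(2))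
    finally have yk: "real (y * k) \<le> K * ln (real p) powr (1 / 2)" .
    define L where "L = nat \<lfloor>(\<alpha> + 1) * log 2 (real p)\<rfloor>"
    have log_pos: "0 \<le> (\<alpha> + 1) * log 2 (real p)" using \<alpha> p2 by simp
    have L: "n ^ k < 2 ^ Suc L"
    proof -
      have "real p powr (\<alpha> + 1) = 2 powr ((\<alpha> + 1) * log 2 (real p))"
        using p2 by (simp add: powr_def log_def)
      also have "\<dots> < 2 powr real (Suc L)" using log_pos by (intro powr_less_mono) (simp_all add: L_def, linarith)
      also have "\<dots> = 2 ^ Suc L" by (subst powr_realpow) auto
      finally show ?thesis using nk_le by simp
    qed
    have SucL: "real (Suc L) \<le> C * ln (real p)"
    proof -
      have "real (Suc L) \<le> (\<alpha> + 1) * log 2 (real p) + 1" using log_pos by (simp add: L_def)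
      also have "\<dots> \<le> (\<alpha> + 1) * log 2 (real p) + ln (real p)" using elim by simp
      also have "\<dots> = C * ln (real p)" by (simp add: C_def log_def algebra_simps)
      finally show ?thesis .
    qed
    have smooth: "(real (Suc L) ^ y) ^ k \<le> real p powr \<sigma>"
    proof -
      have "(real (Suc L) ^ y) ^ k = exp (real (y * k) * ln (real (Suc L)))"
        by (subst power_mult[symmetric]) (simp add: exp_of_nat_mult del: of_nat_Suc of_nat_mult)
      also have "\<dots> \<le> exp (K * ln (real p) powr (1 / 2) * ln (C * ln (real p)))"
        using yk SucL K by (intro iffD2[OF exp_le_cancel_iff] mult_mono ln_mono) auto
      also have "\<dots> \<le> exp (\<sigma> * ln (real p))" using elim(1) by simp
      also have "\<dots> = real p powr \<sigma>" using p2 by (simp add: powr_def)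
      finally show ?thesis .
    qed
    define r where "r = real p powr (- (1 - \<delta>) / real k)"
    have r: "0 < r" using p2 by (simp add: r_def)
    have rk: "r ^ k = real p powr (- (1 - \<delta>))" using p2 kpos by (simp add: r_def powr_power)
    have n1: "1 \<le> n" using n2 by simp
    have "real (card (unit_zeros n)) ^ k \<le>
        10 * n ^ k / real p * ((n ^ k) powr \<sigma> * (real (Suc L) ^ y) ^ k)"
      using \<sigma> by (intro card_unit_zeros_power_le[OF n1 B B6 large _ ky L]) simp
    also have "\<dots> \<le> 10 * n ^ k / real p * ((real p powr (\<alpha> + 1)) powr \<sigma> * real p powr \<sigma>)"
      using smooth nk_le \<sigma> n2 by (intro mult_left_mono mult_mono powr_mono2) auto
    also have "(real p powr (\<alpha> + 1)) powr \<sigma> * real p powr \<sigma> = real p powr \<delta>"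
    proof -
      have "(\<alpha> + 1) * \<sigma> + \<sigma> = (\<alpha> + 2) * \<sigma>" by (simp add: algebra_simps)
      also have "\<dots> = \<delta>" using \<alpha> by (simp add: \<sigma>_def)
      finally show ?thesis by (simp add: powr_powr powr_add[symmetric])
    qed
    also have "10 * n ^ k / real p * real p powr \<delta> = 10 * n ^ k * r ^ k"
      unfolding rk using p2 by (simp add: powr_diff powr_minus_divide)
    also have "\<dots> \<le> (10 * n * r) ^ k"
    proof -
      have "(10 :: real) ^ 1 \<le> 10 ^ k" using kpos by (intro power_increasing) auto
      then have "10 * (n ^ k * r ^ k) \<le> 10 ^ k * (n ^ k * r ^ k)"
        using n2 r by (intro mult_right_mono) auto
      then show ?thesis by (simp add: power_mult_distrib mult.assoc)
    qed
    finally have card_le: "real (card (unit_zeros n)) \<le> 10 * n * r"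
      using kpos n2 r by (subst (asm) power_mono_iff) auto
    \<comment> \<open>The possible extra zero \<open>p\<close> is thereby absorbed, turning 10 into
      11. The bound holds because n^k is at least p^\<alpha>, while r^k is p^(-(1 -
      \<delta>)).\<close>
    have "1 \<le> n * r"
    proof -
      have "real p powr (1 - \<delta>) \<le> real p powr \<alpha>" using \<alpha> \<delta> p2 by (intro powr_mono) auto
      then have "real p powr (1 - \<delta>) * r ^ k \<le> n ^ k * r ^ k"
        using nk_ge r by (intro mult_right_mono order_trans[OF _ nk_ge]) auto
      moreover have "real p powr (1 - \<delta>) * r ^ k = 1"
        unfolding rk using p2 by (simp flip: powr_add)
      ultimately have "1 \<le> n ^ k * r ^ k" by simp
      then have "1 ^ k \<le> (n * r) ^ k" by (simp add: power_mult_distrib)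
      then show ?thesis using kpos n2 r by (subst (asm) power_mono_iff) auto
    qed
    moreover have "card (fermat_zeros p n) \<le> Suc (card (unit_zeros n))"
      by (rule order_trans[OF card_mono[OF _ fermat_zeros_subset[OF n_le]] card_insert_le_m1[of "Suc (card (unit_zeros n))"]]) auto
    ultimately have "real (card (fermat_zeros p n)) \<le> 11 * (n * r)" using card_le by simp
    also have "\<dots> \<le> 11 * (u p * n) * r"
      using elim(5) n2 r by (simp add: mult.assoc mult_left_le_imp_le)
    finally show ?case unfolding r_def k_int n_def .
  qed
qed

text \<open>The functions \<open>e\<close> and \<open>d\<close> stand for the two o(1) terms. The
  constant is fixed before \<open>N\<close> and \<open>u\<close>, and 11 works for every \<alpha>;
  \<open>exponent_of_eventual_bounds\<close> supplies \<open>d\<close>.\<close>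

theorem theorem5:
  fixes \<alpha> :: real
  assumes "\<alpha> > 463 / 252"
  shows "\<exists>c>0. \<forall>(N :: nat \<Rightarrow> real) (u :: nat \<Rightarrow> real).
    (\<forall>p. prime p \<longrightarrow> N p \<ge> 2 \<and> u p = ln (real p) / ln (N p)) \<and>
    (\<forall>\<^sub>F p in primes_at_top. 1 \<le> u p) \<and>
    (\<exists>e :: nat \<Rightarrow> real. (e \<longlongrightarrow> 0) primes_at_top \<and>
       (\<forall>\<^sub>F p in primes_at_top. u p = ln (real p) powr e p))
    \<longrightarrow> (\<exists>d :: nat \<Rightarrow> real. (d \<longlongrightarrow> 0) primes_at_top \<and>
       (\<forall>\<^sub>F p in primes_at_top.
          real (card (fermat_zeros p (N p)))
            \<le> c * (u p * N p * real p powr (- (1 + d p) / of_int \<lceil>\<alpha> * u p\<rceil>))))"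
proof (intro exI[of _ 11] conjI allI impI)
  fix N u :: "nat \<Rightarrow> real"
  assume "(\<forall>p. prime p \<longrightarrow> N p \<ge> 2 \<and> u p = ln (real p) / ln (N p)) \<and>
    (\<forall>\<^sub>F p in primes_at_top. 1 \<le> u p) \<and>
    (\<exists>e :: nat \<Rightarrow> real. (e \<longlongrightarrow> 0) primes_at_top \<and>
       (\<forall>\<^sub>F p in primes_at_top. u p = ln (real p) powr e p))"
  then obtain e where N: "\<And>p. prime p \<Longrightarrow> N p \<ge> 2 \<and> u p = ln (real p) / ln (N p)"
    and u1: "\<forall>\<^sub>F p in primes_at_top. 1 \<le> u p"
    and e0: "(e \<longlongrightarrow> 0) primes_at_top"
    and ue: "\<forall>\<^sub>F p in primes_at_top. u p = ln (real p) powr e p" by blast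
  have "\<exists>d. (d \<longlongrightarrow> 0) primes_at_top \<and> (\<forall>\<^sub>F p in primes_at_top. real (card (fermat_zeros p (N p)))
      \<le> 11 * (u p * N p) * real p powr (- (1 + d p) / of_int \<lceil>\<alpha> * u p\<rceil>))"
  proof (rule exponent_of_eventual_bounds)
    show "\<forall>\<^sub>F p in primes_at_top. real (card (fermat_zeros p (N p)))
      \<le> 11 * (u p * N p) * real p powr (- (1 - \<delta>) / of_int \<lceil>\<alpha> * u p\<rceil>)" if "0 < \<delta>" for \<delta>
      using assms that N u1 e0 ue by (rule card_fermat_zeros_eventually_le)
    show "\<forall>\<^sub>F p in primes_at_top. 0 \<le> real (card (fermat_zeros p (N p))) \<and> 0 < 11 * (u p * N p) \<and>
        0 < real_of_int \<lceil>\<alpha> * u p\<rceil> \<and> 1 < real p"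
      using u1 eventually_prime_primes_at_top
    proof eventually_elim
      case (elim p)
      have "0 < \<alpha> * u p" using assms elim by (intro mult_pos_pos) auto
      then show ?case using elim N[of p] prime_gt_1_nat[of p] by auto
    qed
  qed
  then show "\<exists>d. (d \<longlongrightarrow> 0) primes_at_top \<and> (\<forall>\<^sub>F p in primes_at_top. real (card (fermat_zeros p (N p)))
      \<le> 11 * (u p * N p * real p powr (- (1 + d p) / of_int \<lceil>\<alpha> * u p\<rceil>)))"
    by (simp only: mult.assoc)
qed simp

end
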